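(* Let $\alpha\in(0,1)$, fix $\gamma\in\Gamma$, and suppose that Assumption B (stated in the context) holds for every $h\in\mathcal{H}$. Let $$\lambda=\left\{E_X[f(g(X,\theta_0)|X,\theta_0,\gamma)\nabla_\theta g(X,\theta_0)]\right\}^{-1},\qquad \bar h^-=\lambda\log(1/\alpha),$$ and suppose $\bar h^-\in\mathcal{H}$. Let $\{\hat h_n^-\}$ be a random sequence such that $\sqrt n(\hat h_n^--\bar h^-)=O_{P_{\theta_0+h/n,\gamma}}(1)$ for every fixed $h\in\mathcal{H}$. Define the test $\phi_n(\hat h_n^-,Y^n,X^n)$ to equal $1$ if $$Y_i>g(X_i,\theta_0+\hat h_n^-/n)\text{ for all } i,\quad\text{or}\quad Y_i<g(X_i,\theta_0)\text{ for some } i,$$ and to equal $0$ if $$Y_i\le g(X_i,\theta_0+\hat h_n^-/n)\text{ for some } i,\quad\text{and}\quad Y_i\ge g(X_i,\theta_0)\text{ for all } i.$$ Then $\{\phi_n(\hat h_n^-,Y^n,X^n)\}$ is asymptotically uniformly most powerful (AUMP) in $\mathcal{H}$ at asymptotic level $\alpha$ for the nuisance parameter value $\gamma$ when testing $H_0:h=0$ against $H_1:h\ne0$. That is, $\limsup_nE_{\theta_0,\gamma}[\phi_n]\le\alpha$, and for every other sequence of tests $\{\psi_n\}$ satisfying $\limsup_nE_{\theta_0,\gamma}[\psi_n]\le\alpha$, $$\liminf_nE_{\theta_0+h/n,\gamma}[\phi_n]\ \ge\ \limsup_nE_{\theta_0+h/n,\gamma}[\psi_n]\quad\text{for every } h\ne0\text{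 in }\mathcal{H}.$$
   Context: Model. $(Y,X)$ with $Y$ scalar and $X$ a $d_X$-dimensional vector of discrete covariates with finite support $\mathcal{X}=\{a_1,\ldots,a_L\}$. Conditionally on $X=x$, $Y$ has Lebesgue density $f(y|x,\theta,\gamma)\mathbb{I}\{y\ge g(x,\theta)\}$, where $\theta\in\Theta\subset\mathbb{R}$ is the scalar parameter of interest, $\gamma\in\Gamma\subset\mathbb{R}^d$ is a nuisance parameter, and $\mathbb{I}\{\cdot\}$ is the indicator function. Fix $\theta_0\in\Theta$ and reparametrize $h=n(\theta-\theta_0)\in\mathcal{H}\subset\mathbb{R}$. One observes an i.i.d. sample $(Y^n,X^n)=((Y_1,\ldots,Y_n),(X_1,\ldots,X_n))$. $P_{\theta_0+h/n,\gamma}$ and $E_{\theta_0+h/n,\gamma}$ denote probability and expectation when the sample is drawn from the model with parameters $(\theta_0+h/n,\gamma)$ ($n$ large enough that $\theta_0+h/n\in\Theta$); $E_X$ is expectation over the marginal law of $X$. $O_{P_{\theta_0+h/n,\gamma}}(1)$ means bounded in probability under the sequence $P_{\theta_0+h/n,\gamma}$. A test is a $[0,1]$-valued measurable function of the data, interpreted as the probability of rejecting the null. Expressions such as $g(X_i,\theta_0+\hat h_n/n)$ may be defined arbitrarily on the event (of probability tending to zero) where the plugged-in parameter leaves the parameter space. Assumption B. (i) $\{(Y_i,X_i)\}_{i=1}^n$ is an i.i.d. sample taking values in $\mathcal{Y}\times\mathcal{X}$, $\mathcal{Y}\subset\mathbb{R}$, with $\mathcal{X}=\{a_1,\ldots,a_L\}$,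 and the conditional density of $Y$ given $X=x$ is $f(y|x,\theta,\gamma)\mathbb{I}\{y\ge g(x,\theta)\}$. $\Theta\times\Gamma$ is convex, $\theta_0\in\mathrm{int}(\Theta)$, $\gamma\in\mathrm{int}(\Gamma)$, $0\in\mathcal{H}$. The marginal distribution of $X$ satisfies $\Pr\{X=a_j\}>0$ for each $j=1,\ldots,L$ and does not depend on $(\theta,\gamma)$. (ii) $\{\hat h_n\}$ is a random sequence satisfying $\sqrt n(\hat h_n-\bar h)=O_{P_{\theta_0+h/n,\gamma}}(1)$ for some user-specified constant $\bar h$ (in the claim, $\hat h_n=\hat h_n^-$ and $\bar h=\bar h^-$), and $\{\hat\gamma_n\}$ is a random sequence satisfying $\sqrt n(\hat\gamma_n-\gamma)=O_{P_{\theta_0+h/n,\gamma}}(1)$. (iii) Let $\beta=(\theta,\gamma')'$ and let $\beta_0=(\theta_0,\gamma')'$ with $\gamma$ the fixed true value. $f(y|x,\beta)$ is twice continuously differentiable in $\beta$ for all $y,x$, and $g(x,\theta)$ is continuously differentiable in $\theta$ for all $x$. In some open neighborhood $\mathcal{N}$ of $\beta_0$: $f(y|x,\beta)$ and $\nabla_\beta f(y|x,\beta)$ are continuous in $y$ for $\beta\in\mathcal{N}$; there is a constant $C$ such that $0<f(y|x,\beta)<C<\infty$ and $\|\nabla_\beta f(y|x,\beta)\|<C<\infty$ for all $y,x$ and $\beta\in\mathcal{N}$; and for each $j=1,\ldots,L$, $$\int\sup_{\beta\in\mathcal{N}}\|\nabla_\beta f(y|a_j,\beta)\|\,\mathbb{I}\{y\ge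 g(a_j,\theta)\}\,dy<\infty,$$ $$\int\sup_{\bar\beta,\beta\in\mathcal{N}}\frac{\|\nabla_\beta f(y|a_j,\bar\beta)\|^2}{f(y|a_j,\bar\beta)^2}\mathbb{I}\{y\ge g(a_j,\theta)\}f(y|a_j,\beta)\,dy<\infty,$$ $$\int\sup_{\bar\beta,\beta\in\mathcal{N}}\frac{\|\nabla_{\beta\beta} f(y|a_j,\bar\beta)\|}{f(y|a_j,\bar\beta)}\mathbb{I}\{y\ge g(a_j,\theta)\}f(y|a_j,\beta)\,dy<\infty.$$ $\nabla_\theta g(a_j,\theta_0)>0$ and $\sup_{\beta\in\mathcal{N}}\|\nabla_\theta g(a_j,\theta)\|<\infty$ for each $j=1,\ldots,L$. *)

theory Defs
  imports "HOL-Probability.Probability"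
begin

text \<open>
  Conventions. An observation is a pair \<open>(y, x)\<close> with \<open>y\<close> real and \<open>x\<close> in \<open>real ^ 'k\<close>; the law of \<open>X\<close>
  is the pmf \<open>p\<close>, so the support \<open>{a\<^sub>1, \<dots>, a\<^sub>L}\<close> is \<open>set_pmf p\<close>. The full parameter is
  \<open>\<beta> = (\<theta>, \<gamma>)\<close>, \<open>f y x \<beta>\<close> stands for \<open>f(y | x, \<theta>, \<gamma>)\<close>, and \<open>Yset\<close> is the outcome space. The values of \<open>f\<close>
  are meaningful only for \<open>y \<in> Yset\<close>, \<open>x \<in> set_pmf p\<close> and \<open>\<beta> \<in> \<Theta> \<times> \<Gamma>\<close>, those of \<open>g\<close> only for
  \<open>x \<in> set_pmf p\<close> and \<open>\<theta> \<in> \<Theta>\<close>.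
\<close>

type_synonym 'k obs = "real \<times> (real ^ 'k)"
type_synonym 'k sample = "nat \<Rightarrow> 'k obs"
type_synonym 'd param = "real \<times> (real ^ 'd)"
type_synonym ('k, 'd) dens = "real \<Rightarrow> (real ^ 'k) \<Rightarrow> 'd param \<Rightarrow> real"
type_synonym 'k bdry = "(real ^ 'k) \<Rightarrow> real \<Rightarrow> real"


section \<open>The model\<close>

definition cond_density ::
  "real set \<Rightarrow> ('k::finite, 'd::finite) dens \<Rightarrow> 'k bdry \<Rightarrow> (real ^ 'k) \<Rightarrow> 'd param \<Rightarrow> real \<Rightarrow> real"
  where "cond_density Yset f g x \<beta> y = f y x \<beta> * indicator (Yset \<inter> {g x (fst \<beta>)..}) y"

text \<open>
  The law of one observation has density \<open>Pr{X = x} * f(y | x, \<beta>) * I{y \<ge> g(x, \<theta>)}\<close> with respect to the product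
  of Lebesgue measure and counting measure on the finite support. Using \<open>count_space (set_pmf p)\<close>
  rather than \<open>measure_pmf p\<close> keeps values of \<open>f\<close> and \<open>g\<close> at irrelevant \<open>x\<close> out of measurability questions.
\<close>
definition obs_law ::
  "real set \<Rightarrow> (real ^ 'k) pmf \<Rightarrow> ('k::finite, 'd::finite) dens \<Rightarrow> 'k bdry \<Rightarrow> 'd param \<Rightarrow> 'k obs measure"
  where "obs_law Yset p f g \<beta> =
    density (lborel \<Otimes>\<^sub>M count_space (set_pmf p))
      (\<lambda>(y, x). ennreal (pmf p x * cond_density Yset f g x \<beta> y))"

definition sample_law ::
  "real set \<Rightarrow> (real ^ 'k) pmf \<Rightarrow> ('k::finite, 'd::finite) dens \<Rightarrow> 'k bdry \<Rightarrow> 'd param \<Rightarrow> nat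
    \<Rightarrow> 'k sample measure"
  where "sample_law Yset p f g \<beta> n = (\<Pi>\<^sub>M i\<in>{..<n}. obs_law Yset p f g \<beta>)"

text \<open>The measurable space of samples of size \<open>n\<close>; \<open>sample_law Yset p f g \<beta> n\<close> has the same sets for every \<open>\<beta>\<close>.\<close>
definition sample_space :: "(real ^ 'k::finite) pmf \<Rightarrow> nat \<Rightarrow> 'k sample measure"
  where "sample_space p n = (\<Pi>\<^sub>M i\<in>{..<n}. borel \<Otimes>\<^sub>M count_space (set_pmf p))"

text \<open>
  The sampling distributions under the local parameter \<open>h = n * (\<theta> - \<theta>\<^sub>0)\<close>. Since \<open>\<theta>\<^sub>0\<close> is interior to \<open>\<Theta>\<close>, for each
  \<open>h\<close> only finitely many \<open>n\<close> give \<open>\<theta>\<^sub>0 + h / n\<close> outside \<open>\<Theta>\<close>; these have no influence below because only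
  eventual and limiting behaviour in \<open>n\<close> is used.
\<close>
definition local_law ::
  "real set \<Rightarrow> (real ^ 'k) pmf \<Rightarrow> ('k::finite, 'd::finite) dens \<Rightarrow> 'k bdry \<Rightarrow> real \<Rightarrow> real ^ 'd
    \<Rightarrow> real \<Rightarrow> nat \<Rightarrow> 'k sample measure"
  where "local_law Yset p f g \<theta>0 \<gamma> h n = sample_law Yset p f g (\<theta>0 + h / real n, \<gamma>) n"


section \<open>Asymptotic notions\<close>

definition bounded_in_prob ::
  "(nat \<Rightarrow> 'w measure) \<Rightarrow> (nat \<Rightarrow> 'w \<Rightarrow> 'b::real_normed_vector) \<Rightarrow> bool"
  where "bounded_in_prob P Z \<longleftrightarrow>
    (\<forall>\<epsilon>>0. \<exists>B. \<forall>\<^sub>F n in sequentially. measure (P n) {\<omega> \<in> space (P n). norm (Z n \<omega>) > B} \<le> \<epsilon>)"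

definition test_sequence :: "(nat \<Rightarrow> 'w measure) \<Rightarrow> (nat \<Rightarrow> 'w \<Rightarrow> real) \<Rightarrow> bool"
  where "test_sequence S \<phi> \<longleftrightarrow>
    (\<forall>n. \<phi> n \<in> borel_measurable (S n) \<and> (\<forall>\<omega>\<in>space (S n). 0 \<le> \<phi> n \<omega> \<and> \<phi> n \<omega> \<le> 1))"

definition asymp_level ::
  "(real \<Rightarrow> nat \<Rightarrow> 'w measure) \<Rightarrow> real \<Rightarrow> (nat \<Rightarrow> 'w \<Rightarrow> real) \<Rightarrow> bool"
  where "asymp_level P \<alpha> \<phi> \<longleftrightarrow> limsup (\<lambda>n. ereal (\<integral>\<omega>. \<phi> n \<omega> \<partial>P 0 n)) \<le> ereal \<alpha>"

text \<open>
  \<open>\<phi>\<close> is asymptotically uniformly most powerful in \<open>H\<close> at asymptotic level \<open>\<alpha>\<close> for testing \<open>h = 0\<close> against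
  \<open>h \<noteq> 0\<close>; \<open>S n\<close> is the sample space and \<open>P h n\<close> the law of the sample of size \<open>n\<close> under \<open>h\<close>.
\<close>
definition AUMP ::
  "(nat \<Rightarrow> 'w measure) \<Rightarrow> (real \<Rightarrow> nat \<Rightarrow> 'w measure) \<Rightarrow> real set \<Rightarrow> real \<Rightarrow> (nat \<Rightarrow> 'w \<Rightarrow> real) \<Rightarrow> bool"
  where "AUMP S P H \<alpha> \<phi> \<longleftrightarrow>
    test_sequence S \<phi> \<and> asymp_level P \<alpha> \<phi> \<and>
    (\<forall>\<psi>. test_sequence S \<psi> \<and> asymp_level P \<alpha> \<psi> \<longrightarrow>
      (\<forall>h\<in>H. h \<noteq> 0 \<longrightarrow>
        liminf (\<lambda>n. ereal (\<integral>\<omega>. \<phi> n \<omega> \<partial>P h n)) \<ge> limsup (\<lambda>n. ereal (\<integral>\<omega>. \<psi> n \<omega> \<partial>P h n))))"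


section \<open>Assumption B\<close>

definition assumption_B_i ::
  "real set \<Rightarrow> (real ^ 'd) set \<Rightarrow> real set \<Rightarrow> real set \<Rightarrow> (real ^ 'k) pmf
    \<Rightarrow> ('k::finite, 'd::finite) dens \<Rightarrow> 'k bdry \<Rightarrow> real \<Rightarrow> real ^ 'd \<Rightarrow> bool"
  where "assumption_B_i \<Theta> \<Gamma> H Yset p f g \<theta>0 \<gamma> \<longleftrightarrow>
    Yset \<in> sets borel \<and> finite (set_pmf p) \<and>
    (\<forall>\<beta>\<in>\<Theta> \<times> \<Gamma>. \<forall>x\<in>set_pmf p.
      cond_density Yset f g x \<beta> \<in> borel_measurable borel \<and>
      (\<forall>y. 0 \<le> cond_density Yset f g x \<beta> y) \<and>
      (\<integral>\<^sup>+ y. ennreal (cond_density Yset f g x \<beta> y) \<partial>lborel) = 1) \<and>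
    convex (\<Theta> \<times> \<Gamma>) \<and> \<theta>0 \<in> interior \<Theta> \<and> \<gamma> \<in> interior \<Gamma> \<and> 0 \<in> H"

definition assumption_B_ii ::
  "real set \<Rightarrow> (real ^ 'k) pmf \<Rightarrow> ('k::finite, 'd::finite) dens \<Rightarrow> 'k bdry \<Rightarrow> real \<Rightarrow> real ^ 'd
    \<Rightarrow> real \<Rightarrow> (nat \<Rightarrow> 'k sample \<Rightarrow> real) \<Rightarrow> (nat \<Rightarrow> 'k sample \<Rightarrow> real ^ 'd) \<Rightarrow> real \<Rightarrow> bool"
  where "assumption_B_ii Yset p f g \<theta>0 \<gamma> hbar hhat \<gamma>hat h \<longleftrightarrow>
    (\<forall>n. hhat n \<in> borel_measurable (sample_space p n)) \<and>
    (\<forall>n. \<gamma>hat n \<in> borel_measurable (sample_space p n)) \<and>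
    bounded_in_prob (local_law Yset p f g \<theta>0 \<gamma> h) (\<lambda>n \<omega>. sqrt (real n) * (hhat n \<omega> - hbar)) \<and>
    bounded_in_prob (local_law Yset p f g \<theta>0 \<gamma> h) (\<lambda>n \<omega>. sqrt (real n) *\<^sub>R (\<gamma>hat n \<omega> - \<gamma>))"

text \<open>
  \<open>F\<close> is twice continuously differentiable on \<open>S\<close> with gradient \<open>DF\<close> and Hessian \<open>DDF\<close>, the Hessian being
  viewed as a linear map, with operator norm. At points of \<open>S\<close> on its boundary the derivatives are
  taken within \<open>S\<close>; they are unique, as the sets considered here are convex with nonempty interior.
\<close>
definition twice_cont_differentiable ::
  "'b::euclidean_space set \<Rightarrow> ('b \<Rightarrow> real) \<Rightarrow> ('b \<Rightarrow> 'b) \<Rightarrow> ('b \<Rightarrow> 'b \<Rightarrow>\<^sub>L 'b) \<Rightarrow> bool"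
  where "twice_cont_differentiable S F DF DDF \<longleftrightarrow>
    (\<forall>\<beta>\<in>S. (F has_derivative (\<lambda>v. DF \<beta> \<bullet> v)) (at \<beta> within S)) \<and>
    (\<forall>\<beta>\<in>S. (DF has_derivative blinfun_apply (DDF \<beta>)) (at \<beta> within S)) \<and>
    continuous_on S DDF"

text \<open>
  \<open>Df\<close>, \<open>DDf\<close> and \<open>Dg\<close> are the gradient and Hessian of \<open>f\<close> in \<open>\<beta>\<close> and the derivative of \<open>g\<close> in \<open>\<theta>\<close>. In the integrals the
  indicator is inside the supremum, since it depends on \<open>\<theta> = fst \<beta>\<close>. All statements about \<open>y\<close> range over
  \<open>Yset\<close>; accordingly \<open>g(x, \<theta>)\<close> is required to lie in \<open>Yset\<close> for \<open>\<theta>\<close> near \<open>\<theta>\<^sub>0\<close>, without which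
  \<open>f(g(x, \<theta>) | x, \<beta>)\<close> would have no meaning. This is no condition when \<open>Yset = UNIV\<close>.
\<close>
definition assumption_B_iii ::
  "real set \<Rightarrow> (real ^ 'd) set \<Rightarrow> real set \<Rightarrow> (real ^ 'k) pmf \<Rightarrow> ('k::finite, 'd::finite) dens \<Rightarrow> 'k bdry
    \<Rightarrow> (real \<Rightarrow> (real ^ 'k) \<Rightarrow> 'd param \<Rightarrow> 'd param)
    \<Rightarrow> (real \<Rightarrow> (real ^ 'k) \<Rightarrow> 'd param \<Rightarrow> 'd param \<Rightarrow>\<^sub>L 'd param)
    \<Rightarrow> ((real ^ 'k) \<Rightarrow> real \<Rightarrow> real) \<Rightarrow> real \<Rightarrow> real ^ 'd \<Rightarrow> bool"
  where "assumption_B_iii \<Theta> \<Gamma> Yset p f g Df DDf Dg \<theta>0 \<gamma> \<longleftrightarrow>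
    (\<forall>x\<in>set_pmf p. \<forall>y\<in>Yset.
      twice_cont_differentiable (\<Theta> \<times> \<Gamma>) (\<lambda>\<beta>. f y x \<beta>) (\<lambda>\<beta>. Df y x \<beta>) (\<lambda>\<beta>. DDf y x \<beta>)) \<and>
    (\<forall>x\<in>set_pmf p.
      (\<forall>\<theta>\<in>\<Theta>. (g x has_real_derivative Dg x \<theta>) (at \<theta> within \<Theta>)) \<and> continuous_on \<Theta> (Dg x)) \<and>
    (\<exists>N. open N \<and> (\<theta>0, \<gamma>) \<in> N \<and> N \<subseteq> \<Theta> \<times> \<Gamma> \<and>
      (\<forall>x\<in>set_pmf p. \<forall>\<beta>\<in>N.
        g x (fst \<beta>) \<in> Yset \<and>
        continuous_on Yset (\<lambda>y. f y x \<beta>) \<and> continuous_on Yset (\<lambda>y. Df y x \<beta>)) \<and>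
      (\<exists>C. \<forall>x\<in>set_pmf p. \<forall>\<beta>\<in>N. \<forall>y\<in>Yset. 0 < f y x \<beta> \<and> f y x \<beta> < C \<and> norm (Df y x \<beta>) < C) \<and>
      (\<forall>x\<in>set_pmf p.
        (\<integral>\<^sup>+ y\<in>Yset. (SUP \<beta>\<in>N. ennreal (norm (Df y x \<beta>)) * indicator {g x (fst \<beta>)..} y) \<partial>lborel) < \<infinity> \<and>
        (\<integral>\<^sup>+ y\<in>Yset. (SUP b\<in>N. SUP \<beta>\<in>N.
            ennreal ((norm (Df y x b))\<^sup>2 / (f y x b)\<^sup>2 * f y x \<beta>) * indicator {g x (fst \<beta>)..} y) \<partial>lborel) < \<infinity> \<and>
        (\<integral>\<^sup>+ y\<in>Yset. (SUP b\<in>N. SUP \<beta>\<in>N.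
            ennreal (norm (DDf y x b) / f y x b * f y x \<beta>) * indicator {g x (fst \<beta>)..} y) \<partial>lborel) < \<infinity>) \<and>
      (\<forall>x\<in>set_pmf p. Dg x \<theta>0 > 0 \<and> (\<exists>K. \<forall>\<beta>\<in>N. \<bar>Dg x (fst \<beta>)\<bar> \<le> K)))"


section \<open>The test\<close>

definition boundary_rate ::
  "(real ^ 'k) pmf \<Rightarrow> ('k::finite, 'd::finite) dens \<Rightarrow> 'k bdry \<Rightarrow> ((real ^ 'k) \<Rightarrow> real \<Rightarrow> real)
    \<Rightarrow> real \<Rightarrow> real ^ 'd \<Rightarrow> real"
  where "boundary_rate p f g Dg \<theta>0 \<gamma> =
    inverse (measure_pmf.expectation p (\<lambda>x. f (g x \<theta>0) x (\<theta>0, \<gamma>) * Dg x \<theta>0))"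

text \<open>
  \<open>\<phi>\<close> is a version of the test: it follows the rejection rule whenever \<open>\<theta>\<^sub>0 + hhat / n\<close> lies in \<open>\<Theta>\<close>, and is
  unrestricted (apart from being a test) where \<open>g(X\<^sub>i, \<theta>\<^sub>0 + hhat / n)\<close> is not defined by the model.
\<close>
definition boundary_test ::
  "real set \<Rightarrow> (real ^ 'k) pmf \<Rightarrow> 'k::finite bdry \<Rightarrow> real \<Rightarrow> (nat \<Rightarrow> 'k sample \<Rightarrow> real)
    \<Rightarrow> (nat \<Rightarrow> 'k sample \<Rightarrow> real) \<Rightarrow> bool"
  where "boundary_test \<Theta> p g \<theta>0 hhat \<phi> \<longleftrightarrow>
    test_sequence (sample_space p) \<phi> \<and>
    (\<forall>n. \<forall>\<omega>\<in>space (sample_space p n).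
      let Y = (\<lambda>i. fst (\<omega> i)); X = (\<lambda>i. snd (\<omega> i)); \<theta>hat = \<theta>0 + hhat n \<omega> / real n
      in \<theta>hat \<in> \<Theta> \<longrightarrow>
        ((\<forall>i<n. Y i > g (X i) \<theta>hat) \<or> (\<exists>i<n. Y i < g (X i) \<theta>0) \<longrightarrow> \<phi> n \<omega> = 1) \<and>
        ((\<exists>i<n. Y i \<le> g (X i) \<theta>hat) \<and> (\<forall>i<n. Y i \<ge> g (X i) \<theta>0) \<longrightarrow> \<phi> n \<omega> = 0))"

end

theory Submission
  imports Defs
begin

text \<open>
  \<^bold>\<open>Why the test is optimal.\<close> Write \<open>c = 1 / \<lambda>\<close> and let \<open>A\<^sub>u\<close> be the event that no observation lies below the boundary
  \<open>g(X, \<theta>\<^sub>0 + u / n)\<close>. A shift of \<open>h\<close> moves the lower end of the support by an amount of order \<open>1 / n\<close>, so a given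
  observation falls between the boundaries of \<open>h1 < h2\<close> with probability about \<open>c (h2 - h1) / n\<close>, and the local
  experiment behaves like the shift family of an exponential variable with rate \<open>c\<close>. Two facts make this
  precise: under \<open>h\<close> the event \<open>A\<^sub>u\<close> has limiting probability \<open>exp (- c max (u - h) 0)\<close>
  (\<open>prob_all_above_tendsto\<close>), and for \<open>h1 < h2\<close> the likelihood ratio of \<open>h2\<close> to \<open>h1\<close> is asymptotically at most
  \<open>exp (c (h2 - h1))\<close>, in the sense that \<open>E\<^sub>h\<^sub>2 \<psi> \<le> (1 + \<eta>) exp (c (h2 - h1)) E\<^sub>h\<^sub>1 \<psi> + \<eta>\<close> eventually, for every test
  sequence \<open>\<psi>\<close> and every \<open>\<eta> > 0\<close> (\<open>shift_comparison\<close>).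

  The second fact bounds the power of every test of level \<open>\<alpha> = exp (- c b)\<close> (\<open>envelope_upper_bound\<close>): for \<open>h > 0\<close>
  compare \<open>\<psi>\<close> under \<open>h\<close> with \<open>\<psi>\<close> under \<open>0\<close>; for \<open>h < 0\<close> compare \<open>1 - \<psi>\<close> under \<open>0\<close> with \<open>1 - \<psi>\<close> under \<open>h\<close>. The first fact shows
  that the bound is reached (\<open>envelope_attained\<close>): with high probability the estimated cutoff is within \<open>e\<close> of
  \<open>b\<close>, and then, \<open>g\<close> being increasing, the test lies between \<open>1(A\<^sub>b\<^sub>+\<^sub>e) + 1 - 1(A\<^sub>0)\<close> and \<open>1(A\<^sub>b\<^sub>-\<^sub>e) + 1 - 1(A\<^sub>0)\<close>, whose
  expectations have known limits.

  \<^bold>\<open>Why the likelihood ratio is controlled.\<close> The densities of \<open>h2\<close> and \<open>h1\<close> are compared through square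
  roots rather than logarithms. Restrict the density of one observation under \<open>h1\<close> to the support under \<open>h2\<close>. The
  restricted density has mass \<open>s = 1 - c (h2 - h1) / n + o(1 / n)\<close>. On the common support the square roots of the two densities
  differ in \<open>L\<^sup>2\<close> by \<open>O(1 / n)\<close>, since the score has a bounded second moment near \<open>\<theta>\<^sub>0\<close>; hence the affinity \<open>a\<close> of the
  two densities, which is \<open>(1 + s) / 2\<close> up to \<open>O(1 / n\<^sup>2)\<close>, equals \<open>1 - c (h2 - h1) / (2 n) + o(1 / n)\<close>. Both \<open>s\<close> and \<open>a\<close>
  become \<open>n\<close>th powers for a sample, so with \<open>\<kappa>\<^sup>2 = exp (c (h2 - h1))\<close> the squared \<open>L\<^sup>2\<close> distance between the
  square root of the sample density under \<open>h2\<close> and \<open>\<kappa>\<close> times the restricted one under \<open>h1\<close>, namely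
  \<open>1 + \<kappa>\<^sup>2 s ^ n - 2 \<kappa> a ^ n\<close>, tends to \<open>1 + 1 - 2 = 0\<close>.
\<close>

section \<open>Comparison of product laws by Hellinger affinity\<close>

text \<open>
  Single-observation masses and affinities of the form \<open>1 - w / n + o(1 / n)\<close> enter the comparison of samples as
  \<open>n\<close>th powers.
\<close>
lemma power_tendsto_exp:
  fixes s :: "nat \<Rightarrow> real"
  assumes lim: "(\<lambda>n. real n * (1 - s n)) \<longlonglongrightarrow> w"
  shows "(\<lambda>n. s n ^ n) \<longlonglongrightarrow> exp (- w)"
proof -
  have "(\<lambda>n. (real n * (1 - s n)) * inverse (real n)) \<longlonglongrightarrow> w * 0"
    by (intro tendsto_mult lim lim_inverse_n)
  moreover have "\<forall>\<^sub>F n in sequentially. (real n * (1 - s n)) * inverse (real n) = 1 - s n"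
    using eventually_gt_at_top[of 0] by eventually_elim simp
  ultimately have "(\<lambda>n. 1 - s n) \<longlonglongrightarrow> 0"
    by (simp add: tendsto_cong)
  then have "(\<lambda>n. 1 - (1 - s n)) \<longlonglongrightarrow> 1 - 0"
    by (intro tendsto_diff tendsto_const)
  then have s1: "s \<longlonglongrightarrow> 1" by simp
  then have pos: "\<forall>\<^sub>F n in sequentially. 0 < s n"
    by (rule order_tendstoD) simp
  have "(\<lambda>n. real n * ln (s n)) \<longlonglongrightarrow> - w"
  proof (rule tendsto_sandwich)
    show "(\<lambda>n. - (real n * (1 - s n)) / s n) \<longlonglongrightarrow> - w"
      using tendsto_divide[OF tendsto_minus[OF lim] s1] by simp
    show "(\<lambda>n. - (real n * (1 - s n))) \<longlonglongrightarrow> - w"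
      by (intro tendsto_minus lim)
    show "\<forall>\<^sub>F n in sequentially. - (real n * (1 - s n)) / s n \<le> real n * ln (s n)"
      using pos
    proof eventually_elim
      case (elim n)
      have "ln (inverse (s n)) \<le> inverse (s n) - 1"
        using elim by (intro ln_le_minus_one) simp
      then have "1 - inverse (s n) \<le> ln (s n)"
        using elim by (simp add: ln_inverse)
      then have "real n * (1 - inverse (s n)) \<le> real n * ln (s n)"
        by (intro mult_left_mono) auto
      then show ?case
        using elim by (simp add: field_simps)
    qed
    show "\<forall>\<^sub>F n in sequentially. real n * ln (s n) \<le> - (real n * (1 - s n))"
      using pos
    proof eventually_elim
      case (elim n)
      then have "real n * ln (s n) \<le> real n * (s n - 1)"
        by (intro mult_left_mono ln_le_minus_one) auto
      then show ?case by (simp add: algebra_simps)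
    qed
  qed
  then have "(\<lambda>n. exp (real n * ln (s n))) \<longlonglongrightarrow> exp (- w)"
    by (rule tendsto_exp)
  moreover have "\<forall>\<^sub>F n in sequentially. exp (real n * ln (s n)) = s n ^ n"
    using pos by eventually_elim (simp add: exp_of_nat_mult)
  ultimately show ?thesis by (simp add: tendsto_cong)
qed

text \<open>
  A sample law becomes a single density with respect to a common measure, so that two sample laws can be
  compared pointwise.
\<close>
lemma PiM_density_power:
  fixes k :: "'a \<Rightarrow> real"
  assumes M: "sigma_finite_measure M"
    and k: "k \<in> borel_measurable M" "\<And>z. 0 \<le> k z" "(\<integral>\<^sup>+z. k z \<partial>M) = 1"
  shows "(\<Pi>\<^sub>M i\<in>{..<n::nat}. density M (\<lambda>z. ennreal (k z)))
    = density (\<Pi>\<^sub>M i\<in>{..<n}. M) (\<lambda>\<omega>. ennreal (\<Prod>i<n. k (\<omega> i)))"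
proof -
  interpret M: sigma_finite_measure M by (rule M)
  interpret PM: product_sigma_finite "\<lambda>_::nat. M" by unfold_locales
  have "prob_space (density M k)"
    using k by (intro prob_spaceI) (simp add: emeasure_density cong: nn_integral_cong)
  then interpret D: prob_space "density M k" .
  interpret PD: product_sigma_finite "\<lambda>_::nat. density M k" by unfold_locales
  note k(1)[measurable]
  have "density (Pi\<^sub>M {..<n} (\<lambda>i. M)) (\<lambda>\<omega>. ennreal (\<Prod>i<n. k (\<omega> i))) = (\<Pi>\<^sub>M i\<in>{..<n}. density M k)"
  proof (rule PD.PiM_eqI)
    show "finite {..<n}" by simp
    show "sets (density (Pi\<^sub>M {..<n} (\<lambda>i. M)) (\<lambda>\<omega>. ennreal (\<Prod>i<n. k (\<omega> i)))) = sets (\<Pi>\<^sub>M i\<in>{..<n}. density M k)"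
      by (simp cong: sets_PiM_cong)
    fix A assume A: "\<And>i. i \<in> {..<n} \<Longrightarrow> A i \<in> sets (density M (\<lambda>x. ennreal (k x)))"
    then have A': "\<And>i. i < n \<Longrightarrow> A i \<in> sets M" by simp
    have "emeasure (density (Pi\<^sub>M {..<n} (\<lambda>i. M)) (\<lambda>\<omega>. ennreal (\<Prod>i<n. k (\<omega> i)))) (Pi\<^sub>E {..<n} A)
      = (\<integral>\<^sup>+\<omega>. ennreal (\<Prod>i<n. k (\<omega> i)) * indicator (Pi\<^sub>E {..<n} A) \<omega> \<partial>Pi\<^sub>M {..<n} (\<lambda>i. M))"
      using A' by (intro emeasure_density) (auto intro!: sets_PiM_I_finite)
    also have "\<dots> = (\<integral>\<^sup>+\<omega>. (\<Prod>i<n. ennreal (k (\<omega> i)) * indicator (A i) (\<omega> i)) \<partial>Pi\<^sub>M {..<n} (\<lambda>i. M))"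
    proof (rule nn_integral_cong)
      fix \<omega> assume "\<omega> \<in> space (Pi\<^sub>M {..<n} (\<lambda>i. M))"
      then have "indicator (Pi\<^sub>E {..<n} A) \<omega> = (\<Prod>i<n. indicator (A i) (\<omega> i) :: ennreal)"
        by (auto simp: indicator_def space_PiM PiE_def Pi_def prod_zero_iff)
      then show "ennreal (\<Prod>i<n. k (\<omega> i)) * indicator (Pi\<^sub>E {..<n} A) \<omega>
        = (\<Prod>i<n. ennreal (k (\<omega> i)) * indicator (A i) (\<omega> i))"
        using k(2) by (simp add: prod.distrib prod_ennreal)
    qed
    also have "\<dots> = (\<Prod>i<n. \<integral>\<^sup>+z. ennreal (k z) * indicator (A i) z \<partial>M)"
      using A' by (intro PM.product_nn_integral_prod) auto
    also have "\<dots> = (\<Prod>i<n. emeasure (density M k) (A i))"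
      using A' by (intro prod.cong) (auto simp: emeasure_density)
    finally show "emeasure (density (Pi\<^sub>M {..<n} (\<lambda>i. M)) (\<lambda>\<omega>. ennreal (\<Prod>i<n. k (\<omega> i)))) (Pi\<^sub>E {..<n} A)
      = (\<Prod>i<n. emeasure (density M k) (A i))" .
  qed
  then show ?thesis by simp
qed

text \<open>
  With \<open>u\<^sup>2\<close> and \<open>v\<^sup>2\<close> the two densities being compared, this trades a factor \<open>1 + \<eta>\<close> for an error that is small when the
  square roots are close in \<open>L\<^sup>2\<close>. It is \<open>(\<eta> v - (u - v))\<^sup>2 \<ge> 0\<close>.
\<close>
lemma square_le_near_square:
  fixes u v \<eta> :: real
  assumes "0 < \<eta>"
  shows "u\<^sup>2 \<le> (1 + \<eta>) * v\<^sup>2 + (1 + 1 / \<eta>) * (u - v)\<^sup>2"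
proof -
  have "0 \<le> (\<eta> * v - (u - v))\<^sup>2 / \<eta>"
    using assms by simp
  also have "\<dots> = (1 + \<eta>) * v\<^sup>2 + (1 + 1 / \<eta>) * (u - v)\<^sup>2 - u\<^sup>2"
    using assms by (simp add: field_simps power2_eq_square)
  finally show ?thesis by simp
qed

lemma sqrt_prod: "sqrt (\<Prod>i\<in>I. a i) = (\<Prod>i\<in>I. sqrt (a i))"
  by (induction I rule: infinite_finite_induct) (auto simp: real_sqrt_mult)

text \<open>
  Expectations of a test under two product laws, with an error given by single-observation integrals.
  The auxiliary \<open>r \<le> q\<close> is meant to be \<open>q\<close> restricted to the support of \<open>p\<close>: then \<open>\<kappa>\<close> times the square root of
  \<open>\<Prod>r\<close> can be close to the square root of \<open>\<Prod>p\<close> although \<open>\<Prod>q\<close> has much mass outside the support of \<open>\<Prod>p\<close>. The last term is the squared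
  \<open>L\<^sup>2\<close> distance of these two functions, and it is explicit because masses and affinities are multiplicative
  over products.
\<close>
lemma product_density_comparison:
  fixes p q r :: "'a \<Rightarrow> real" and \<psi> :: "(nat \<Rightarrow> 'a) \<Rightarrow> real"
  assumes M: "sigma_finite_measure M"
    and p: "p \<in> borel_measurable M" "\<And>z. 0 \<le> p z" "(\<integral>\<^sup>+z. p z \<partial>M) = 1"
    and q: "q \<in> borel_measurable M" "\<And>z. 0 \<le> q z" "(\<integral>\<^sup>+z. q z \<partial>M) = 1"
    and r: "r \<in> borel_measurable M" "\<And>z. 0 \<le> r z" "\<And>z. r z \<le> q z"
    and \<psi>: "\<psi> \<in> borel_measurable (\<Pi>\<^sub>M i\<in>{..<n}. M)"
      "\<And>\<omega>. \<omega> \<in> space (\<Pi>\<^sub>M i\<in>{..<n}. M) \<Longrightarrow> 0 \<le> \<psi> \<omega> \<and> \<psi> \<omega> \<le> 1"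
    and \<eta>: "0 < \<eta>"
  shows "(\<integral>\<omega>. \<psi> \<omega> \<partial>(\<Pi>\<^sub>M i\<in>{..<n}. density M (\<lambda>z. ennreal (p z))))
    \<le> (1 + \<eta>) * \<kappa>\<^sup>2 * (\<integral>\<omega>. \<psi> \<omega> \<partial>(\<Pi>\<^sub>M i\<in>{..<n}. density M (\<lambda>z. ennreal (q z))))
      + (1 + 1 / \<eta>) * (1 + \<kappa>\<^sup>2 * (\<integral>z. r z \<partial>M) ^ n - 2 * \<kappa> * (\<integral>z. sqrt (p z * r z) \<partial>M) ^ n)"
proof -
  interpret M: sigma_finite_measure M by (rule M)
  interpret PM: product_sigma_finite "\<lambda>_::nat. M" by unfold_locales
  note [measurable] = p(1) q(1) r(1) \<psi>(1)
  let ?W = "\<Pi>\<^sub>M i\<in>{..<n}. M"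
  define P where "P \<omega> = (\<Prod>i<n. p (\<omega> i))" for \<omega>
  define Q where "Q \<omega> = (\<Prod>i<n. q (\<omega> i))" for \<omega>
  define R where "R \<omega> = (\<Prod>i<n. r (\<omega> i))" for \<omega>
  have nonneg: "0 \<le> P \<omega>" "0 \<le> Q \<omega>" "0 \<le> R \<omega>" "R \<omega> \<le> Q \<omega>" for \<omega>
    using p q r by (auto simp: P_def Q_def R_def intro!: prod_nonneg prod_mono)
  have [measurable]: "P \<in> borel_measurable ?W" "Q \<in> borel_measurable ?W" "R \<in> borel_measurable ?W"
    unfolding P_def Q_def R_def by measurable
  have ip: "integrable M p" "integral\<^sup>L M p = 1"
    using p by (auto intro: integrableI_nonneg simp: integral_eq_nn_integral)
  have iq: "integrable M q" "integral\<^sup>L M q = 1"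
    using q by (auto intro: integrableI_nonneg simp: integral_eq_nn_integral)
  have ir: "integrable M r"
    by (rule Bochner_Integration.integrable_bound[OF iq(1)]) (use q r in auto)
  have ipr: "integrable M (\<lambda>z. sqrt (p z * r z))"
  proof (rule Bochner_Integration.integrable_bound)
    show "integrable M (\<lambda>z. p z + r z)" using ip ir by simp
    have "sqrt (p z * r z) \<le> p z + r z" for z
      using arith_geo_mean_sqrt[of "p z" "r z"] p(2)[of z] r(2)[of z] by simp
    then show "AE z in M. norm (sqrt (p z * r z)) \<le> norm (p z + r z)"
      using p(2) r(2) by (simp add: add_nonneg_nonneg)
  qed measurable
  have IP: "integrable ?W P" "integral\<^sup>L ?W P = 1"
    unfolding P_def using ip PM.product_integral_prod[of "{..<n}" "\<lambda>_. p"]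
    by (auto intro!: PM.product_integrable_prod)
  have IQ: "integrable ?W Q"
    unfolding Q_def using iq by (auto intro!: PM.product_integrable_prod)
  have IR: "integrable ?W R" "integral\<^sup>L ?W R = (\<integral>z. r z \<partial>M) ^ n"
    unfolding R_def using ir PM.product_integral_prod[of "{..<n}" "\<lambda>_. r"]
    by (auto intro!: PM.product_integrable_prod)
  have PR: "sqrt (P \<omega>) * sqrt (R \<omega>) = (\<Prod>i<n. sqrt (p (\<omega> i) * r (\<omega> i)))" for \<omega>
    by (simp add: P_def R_def sqrt_prod real_sqrt_mult prod.distrib)
  have IPR: "integrable ?W (\<lambda>\<omega>. sqrt (P \<omega>) * sqrt (R \<omega>))"
    "(\<integral>\<omega>. sqrt (P \<omega>) * sqrt (R \<omega>) \<partial>?W) = (\<integral>z. sqrt (p z * r z) \<partial>M) ^ n"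
    unfolding PR using ipr PM.product_integral_prod[of "{..<n}" "\<lambda>_ z. sqrt (p z * r z)"]
    by (auto intro!: PM.product_integrable_prod)
  define D where "D \<omega> = (sqrt (P \<omega>) - \<kappa> * sqrt (R \<omega>))\<^sup>2" for \<omega>
  have D: "D \<omega> = P \<omega> + \<kappa>\<^sup>2 * R \<omega> - 2 * \<kappa> * (sqrt (P \<omega>) * sqrt (R \<omega>))" for \<omega>
    using nonneg[of \<omega>] by (simp add: D_def power2_diff power_mult_distrib)
  have ID: "integrable ?W D"
    "integral\<^sup>L ?W D = 1 + \<kappa>\<^sup>2 * (\<integral>z. r z \<partial>M) ^ n - 2 * \<kappa> * (\<integral>z. sqrt (p z * r z) \<partial>M) ^ n"
    unfolding D using IP IR IPR by simp_all
  have I\<psi>P: "integrable ?W (\<lambda>\<omega>. P \<omega> * \<psi> \<omega>)"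
    by (rule Bochner_Integration.integrable_bound[OF IP(1)])
      (use nonneg \<psi>(2) in \<open>auto simp: abs_mult intro!: mult_left_le\<close>)
  have I\<psi>Q: "integrable ?W (\<lambda>\<omega>. Q \<omega> * \<psi> \<omega>)"
    by (rule Bochner_Integration.integrable_bound[OF IQ])
      (use nonneg \<psi>(2) in \<open>auto simp: abs_mult intro!: mult_left_le\<close>)
  have "(\<integral>\<omega>. \<psi> \<omega> \<partial>(\<Pi>\<^sub>M i\<in>{..<n}. density M (\<lambda>z. ennreal (p z)))) = (\<integral>\<omega>. P \<omega> * \<psi> \<omega> \<partial>?W)"
    unfolding PiM_density_power[OF M p] using nonneg by (simp add: integral_density flip: P_def)
  also have "\<dots> \<le> (\<integral>\<omega>. (1 + \<eta>) * \<kappa>\<^sup>2 * (Q \<omega> * \<psi> \<omega>) + (1 + 1 / \<eta>) * D \<omega> \<partial>?W)"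
  proof (rule integral_mono)
    show "integrable ?W (\<lambda>\<omega>. (1 + \<eta>) * \<kappa>\<^sup>2 * (Q \<omega> * \<psi> \<omega>) + (1 + 1 / \<eta>) * D \<omega>)"
      using I\<psi>Q ID(1) by simp
    fix \<omega> assume \<omega>: "\<omega> \<in> space ?W"
    have "P \<omega> \<le> (1 + \<eta>) * (\<kappa>\<^sup>2 * R \<omega>) + (1 + 1 / \<eta>) * D \<omega>"
      using square_le_near_square[OF \<eta>, of "sqrt (P \<omega>)" "\<kappa> * sqrt (R \<omega>)"] nonneg[of \<omega>]
      by (simp add: D_def power_mult_distrib)
    then have "P \<omega> * \<psi> \<omega> \<le> ((1 + \<eta>) * (\<kappa>\<^sup>2 * R \<omega>) + (1 + 1 / \<eta>) * D \<omega>) * \<psi> \<omega>"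
      using \<psi>(2)[OF \<omega>] by (intro mult_right_mono) auto
    also have "\<dots> = (1 + \<eta>) * \<kappa>\<^sup>2 * (R \<omega> * \<psi> \<omega>) + (1 + 1 / \<eta>) * (D \<omega> * \<psi> \<omega>)"
      by (simp add: algebra_simps)
    also have "\<dots> \<le> (1 + \<eta>) * \<kappa>\<^sup>2 * (Q \<omega> * \<psi> \<omega>) + (1 + 1 / \<eta>) * D \<omega>"
      using \<psi>(2)[OF \<omega>] nonneg[of \<omega>] \<eta>
      by (intro add_mono mult_left_mono mult_right_mono mult_left_le) (auto simp: D_def)
    finally show "P \<omega> * \<psi> \<omega> \<le> (1 + \<eta>) * \<kappa>\<^sup>2 * (Q \<omega> * \<psi> \<omega>) + (1 + 1 / \<eta>) * D \<omega>" .
  qed (rule I\<psi>P)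
  also have "\<dots> = (1 + \<eta>) * \<kappa>\<^sup>2 * (\<integral>\<omega>. Q \<omega> * \<psi> \<omega> \<partial>?W) + (1 + 1 / \<eta>) * integral\<^sup>L ?W D"
    using I\<psi>Q ID(1) by simp
  also have "(\<integral>\<omega>. Q \<omega> * \<psi> \<omega> \<partial>?W) = (\<integral>\<omega>. \<psi> \<omega> \<partial>(\<Pi>\<^sub>M i\<in>{..<n}. density M (\<lambda>z. ennreal (q z))))"
    unfolding PiM_density_power[OF M q] using nonneg by (simp add: integral_density flip: Q_def)
  finally show ?thesis by (simp add: ID(2))
qed

section \<open>The power envelope of the one-sided exponential shift\<close>

lemma limsup_ereal_le_iff:
  fixes X :: "nat \<Rightarrow> real"
  shows "limsup (\<lambda>n. ereal (X n)) \<le> ereal a \<longleftrightarrow> (\<forall>e>0. \<forall>\<^sub>F n in sequentially. X n < a + e)"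
proof
  assume *: "limsup (\<lambda>n. ereal (X n)) \<le> ereal a"
  show "\<forall>e>0. \<forall>\<^sub>F n in sequentially. X n < a + e"
  proof (intro allI impI)
    fix e :: real assume "e > 0"
    then have "ereal a < ereal (a + e)" by simp
    then have "\<forall>\<^sub>F n in sequentially. ereal (X n) < ereal (a + e)"
      using * unfolding Limsup_le_iff by blast
    then show "\<forall>\<^sub>F n in sequentially. X n < a + e" by simp
  qed
next
  assume *: "\<forall>e>0. \<forall>\<^sub>F n in sequentially. X n < a + e"
  show "limsup (\<lambda>n. ereal (X n)) \<le> ereal a"
    unfolding Limsup_le_iff
  proof (intro allI impI)
    fix y assume y: "ereal a < y"
    then obtain b where b: "ereal a < ereal b" "ereal b \<le> y"
      using ereal_dense2 less_imp_le by blast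
    then have "\<forall>\<^sub>F n in sequentially. X n < a + (b - a)"
      using * b(1) by (metis diff_gt_0_iff_gt less_ereal.simps(1))
    then show "\<forall>\<^sub>F n in sequentially. ereal (X n) < y"
      by (rule eventually_mono) (auto intro!: order_less_le_trans[OF _ b(2)])
  qed
qed

text \<open>
  The largest power at \<open>h\<close> of a test of level \<open>exp (- c * b)\<close> for \<open>h = 0\<close>, based on one exponential variable with rate \<open>c\<close>
  shifted by \<open>h\<close>, where \<open>b \<ge> 0\<close>. It is \<open>min 1 (exp (- c * (b - h)))\<close> for \<open>h \<ge> 0\<close> and
  \<open>1 - (1 - exp (- c * b)) * exp (c * h)\<close> for \<open>h \<le> 0\<close>; the test that rejects when the variable is at least \<open>b\<close> or below \<open>0\<close>
  has this power at every \<open>h\<close>.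
\<close>
definition power_envelope :: "real \<Rightarrow> real \<Rightarrow> real \<Rightarrow> real"
  where "power_envelope c b h = exp (- c * max (b - h) 0) + 1 - exp (- c * max (- h) 0)"

text \<open>
  Fixes the slack \<open>\<eta>\<close> of the power bounds below, which hold for each \<open>\<eta> > 0\<close> and are sharp only as \<open>\<eta>\<close> tends to \<open>0\<close>.
\<close>
lemma eventually_at_right_less:
  fixes F :: "real \<Rightarrow> real"
  assumes "(F \<longlongrightarrow> F 0) (at_right 0)" "F 0 < b"
  obtains \<eta> where "0 < \<eta>" "\<eta> < 1" "F \<eta> < b"
proof -
  have "\<forall>\<^sub>F x in at_right 0. F x < b"
    using assms by (rule order_tendstoD)
  moreover have "\<forall>\<^sub>F x in at_right (0::real). 0 < x \<and> x < 1"
    using eventually_at_right_real[of 0 1] by simp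
  ultimately have "\<forall>\<^sub>F x in at_right 0. 0 < x \<and> x < 1 \<and> F x < b"
    by eventually_elim simp
  then show ?thesis
    using that eventually_happens trivial_limit_at_right_real by blast
qed

text \<open>
  A likelihood ratio bound \<open>exp (c * (h2 - h1))\<close> for \<open>h1 < h2\<close> is all that the power bound needs, on both sides of
  the null: for \<open>h > 0\<close> it limits the power that \<open>\<psi>\<close> can gain between \<open>0\<close> and \<open>h\<close>, and for \<open>h < 0\<close> it limits what the
  expectation of \<open>1 - \<psi>\<close> can gain between \<open>h\<close> and \<open>0\<close>, where it must reach \<open>1 - exp (- c * b)\<close> in the limit. For \<open>h \<ge> b\<close> the bound is \<open>1\<close>.
\<close>
lemma envelope_upper_bound:
  fixes P :: "real \<Rightarrow> nat \<Rightarrow> 'w measure"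
  assumes c: "0 < c" and b: "0 < b"
    and prob: "\<And>h. \<forall>\<^sub>F n in sequentially. prob_space (P h n) \<and> sets (P h n) = sets (S n)"
    and compare: "\<And>h1 h2 \<psi> \<eta>. h1 < h2 \<Longrightarrow> test_sequence S \<psi> \<Longrightarrow> 0 < \<eta> \<Longrightarrow>
      \<forall>\<^sub>F n in sequentially. (\<integral>\<omega>. \<psi> n \<omega> \<partial>P h2 n)
        \<le> (1 + \<eta>) * exp (c * (h2 - h1)) * (\<integral>\<omega>. \<psi> n \<omega> \<partial>P h1 n) + \<eta>"
    and \<psi>: "test_sequence S \<psi>" "asymp_level P (exp (- c * b)) \<psi>"
    and h: "h \<noteq> 0"
  shows "limsup (\<lambda>n. ereal (\<integral>\<omega>. \<psi> n \<omega> \<partial>P h n)) \<le> ereal (power_envelope c b h)"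
  unfolding limsup_ereal_le_iff
proof (intro allI impI)
  fix e :: real assume e: "0 < e"
  define \<alpha> where "\<alpha> = exp (- c * b)"
  have test: "\<psi> n \<in> borel_measurable (S n)" "\<And>\<omega>. \<omega> \<in> space (S n) \<Longrightarrow> 0 \<le> \<psi> n \<omega> \<and> \<psi> n \<omega> \<le> 1" for n
    using \<psi>(1) by (auto simp: test_sequence_def)
  have int: "\<forall>\<^sub>F n in sequentially. prob_space (P h' n) \<and> integrable (P h' n) (\<psi> n)
      \<and> 0 \<le> (\<integral>\<omega>. \<psi> n \<omega> \<partial>P h' n) \<and> (\<integral>\<omega>. \<psi> n \<omega> \<partial>P h' n) \<le> 1" for h'
    using prob[of h']
  proof eventually_elim
    case (elim n)
    interpret prob_space "P h' n" using elim by simp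
    have sp: "space (P h' n) = space (S n)" using elim by (metis sets_eq_imp_space_eq)
    have m: "\<psi> n \<in> borel_measurable (P h' n)"
      using elim test(1)[of n] by (auto cong: measurable_cong_sets)
    have i: "integrable (P h' n) (\<psi> n)"
      by (rule integrable_const_bound[where B=1]) (use m test(2)[of _ n] sp in \<open>auto\<close>)
    moreover have "(\<integral>\<omega>. \<psi> n \<omega> \<partial>P h' n) \<le> (\<integral>\<omega>. 1 \<partial>P h' n)"
      using i test(2)[of _ n] sp by (intro integral_mono) auto
    moreover have "0 \<le> (\<integral>\<omega>. \<psi> n \<omega> \<partial>P h' n)"
      using test(2)[of _ n] sp by (intro integral_nonneg_AE) auto
    ultimately show ?case using elim by (simp add: prob_space)
  qed
  have level: "\<forall>\<^sub>F n in sequentially. (\<integral>\<omega>. \<psi> n \<omega> \<partial>P 0 n) < \<alpha> + \<eta>" if "0 < \<eta>" for \<eta>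
    using \<psi>(2) that unfolding asymp_level_def limsup_ereal_le_iff \<alpha>_def by simp
  consider "0 < h" "h < b" | "b \<le> h" | "h < 0" using h by linarith
  then show "\<forall>\<^sub>F n in sequentially. (\<integral>\<omega>. \<psi> n \<omega> \<partial>P h n) < power_envelope c b h + e"
  proof cases
    case 1
    have env: "power_envelope c b h = exp (c * h) * \<alpha>"
      using 1 by (simp add: power_envelope_def \<alpha>_def right_diff_distrib flip: exp_add)
    define F where "F \<eta> = (1 + \<eta>) * exp (c * h) * (\<alpha> + \<eta>) + \<eta>" for \<eta>
    have "(F \<longlongrightarrow> F 0) (at_right 0)" unfolding F_def by (intro tendsto_intros)
    moreover have "F 0 < power_envelope c b h + e" using e by (simp add: F_def env)
    ultimately obtain \<eta> where \<eta>: "0 < \<eta>" "\<eta> < 1" "F \<eta> < power_envelope c b h + e"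
      by (rule eventually_at_right_less)
    show ?thesis
      using compare[OF 1(1) \<psi>(1) \<eta>(1)] level[OF \<eta>(1)]
    proof eventually_elim
      case (elim n)
      have "(\<integral>\<omega>. \<psi> n \<omega> \<partial>P h n) \<le> (1 + \<eta>) * exp (c * h) * (\<integral>\<omega>. \<psi> n \<omega> \<partial>P 0 n) + \<eta>"
        using elim(1) by simp
      also have "\<dots> \<le> F \<eta>"
        unfolding F_def using elim(2) \<eta> by (intro add_right_mono mult_left_mono) auto
      finally show ?case using \<eta> by simp
    qed
  next
    case 2
    then have "power_envelope c b h = 1"
      using b by (simp add: power_envelope_def)
    then show ?thesis
      using int[of h] e by (auto elim!: eventually_mono)
  next
    case 3
    have env: "power_envelope c b h = 1 - (1 - \<alpha>) * exp (c * h)"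
      using 3 b by (simp add: power_envelope_def \<alpha>_def right_diff_distrib left_diff_distrib flip: exp_add)
    \<comment> \<open>The bound on the power at \<open>h\<close> obtained by solving \<open>1 - \<alpha> - \<eta> \<le> (1 + \<eta>) * exp (- c * h) * E\<^sub>h (1 - \<psi>) + \<eta>\<close>.\<close>
    define F where "F \<eta> = 1 - (1 - \<alpha> - 2 * \<eta>) / (1 + \<eta>) * exp (c * h)" for \<eta>
    have "(F \<longlongrightarrow> F 0) (at_right 0)" unfolding F_def by (intro tendsto_intros) simp
    moreover have "F 0 < power_envelope c b h + e" using e by (simp add: F_def env)
    ultimately obtain \<eta> where \<eta>: "0 < \<eta>" "\<eta> < 1" "F \<eta> < power_envelope c b h + e"
      by (rule eventually_at_right_less)
    have comp: "test_sequence S (\<lambda>n \<omega>. 1 - \<psi> n \<omega>)"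
      using \<psi>(1) by (auto simp: test_sequence_def intro!: borel_measurable_diff)
    show ?thesis
      using compare[OF 3 comp \<eta>(1)] level[OF \<eta>(1)] int[of h] int[of 0]
    proof eventually_elim
      case (elim n)
      have E: "(\<integral>\<omega>. 1 - \<psi> n \<omega> \<partial>P h' n) = 1 - (\<integral>\<omega>. \<psi> n \<omega> \<partial>P h' n)"
        if "prob_space (P h' n)" "integrable (P h' n) (\<psi> n)" for h'
        using that by (subst Bochner_Integration.integral_diff)
          (auto simp: prob_space.prob_space prob_space.finite_measure finite_measure.integrable_const)
      have "1 - \<alpha> - 2 * \<eta> \<le> (1 + \<eta>) * exp (- c * h) * (1 - (\<integral>\<omega>. \<psi> n \<omega> \<partial>P h n))"
        using elim E[of h] E[of 0] by simp
      then have "(1 - \<alpha> - 2 * \<eta>) * exp (c * h)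
        \<le> (1 + \<eta>) * exp (- c * h) * (1 - (\<integral>\<omega>. \<psi> n \<omega> \<partial>P h n)) * exp (c * h)"
        by (intro mult_right_mono) auto
      also have "\<dots> = (1 + \<eta>) * (1 - (\<integral>\<omega>. \<psi> n \<omega> \<partial>P h n))"
        by (simp add: exp_minus)
      finally have "(\<integral>\<omega>. \<psi> n \<omega> \<partial>P h n) \<le> F \<eta>"
        using \<eta> by (simp add: F_def field_simps)
      then show ?case using \<eta> by simp
    qed
  qed
qed

text \<open>
  Here \<open>A u n\<close> plays the part of the event that the exponential limit variable is at least \<open>u\<close>. The sandwich says that,
  whenever the random cutoff \<open>T n\<close> is within \<open>e\<close> of \<open>b\<close>, the test lies between the optimal tests with cutoffs \<open>b + e\<close> and
  \<open>b - e\<close>; so its expectation is squeezed between limits that meet at the envelope as \<open>e\<close> tends to \<open>0\<close>.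
\<close>
lemma envelope_attained:
  fixes P :: "nat \<Rightarrow> 'w measure"
  assumes b: "0 < b"
    and prob: "\<forall>\<^sub>F n in sequentially. prob_space (P n) \<and> sets (P n) = sets (S n)"
    and \<phi>: "test_sequence S \<phi>"
    and A_sets: "\<And>u n. A u n \<in> sets (S n)"
    and A_prob: "\<And>u. (\<lambda>n. measure (P n) (A u n)) \<longlonglongrightarrow> exp (- c * max (u - h) 0)"
    and T: "\<And>n. T n \<in> borel_measurable (S n)"
    and T_lim: "\<And>e. 0 < e \<Longrightarrow> (\<lambda>n. measure (P n) {\<omega> \<in> space (P n). e \<le> \<bar>T n \<omega> - b\<bar>}) \<longlonglongrightarrow> 0"
    and sandwich: "\<And>e. 0 < e \<Longrightarrow> e < b \<Longrightarrow> \<forall>\<^sub>F n in sequentially. \<forall>\<omega>\<in>space (S n). \<bar>T n \<omega> - b\<bar> < e \<longrightarrow>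
      indicator (A (b + e) n) \<omega> + 1 - indicator (A 0 n) \<omega> \<le> \<phi> n \<omega> \<and>
      \<phi> n \<omega> \<le> indicator (A (b - e) n) \<omega> + 1 - indicator (A 0 n) \<omega>"
  shows "(\<lambda>n. \<integral>\<omega>. \<phi> n \<omega> \<partial>P n) \<longlonglongrightarrow> power_envelope c b h"
proof (rule LIMSEQ_I)
  fix \<delta> :: real assume \<delta>: "0 < \<delta>"
  define G where "G e u = exp (- c * max (b + u * e - h) 0) + 1 - exp (- c * max (0 - h) 0)" for e u :: real
  \<comment> \<open>The term \<open>e * (\<delta> / b)\<close> forces \<open>e < b\<close> once the sum is below \<open>\<delta>\<close>.\<close>
  define F where "F e = \<bar>G e 1 - G 0 0\<bar> + \<bar>G e (-1) - G 0 0\<bar> + e * (\<delta> / b)" for e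
  have "(F \<longlongrightarrow> F 0) (at_right 0)"
    unfolding F_def G_def by (intro tendsto_intros)
  moreover have "F 0 < \<delta>" using \<delta> by (simp add: F_def G_def)
  ultimately obtain e where e: "0 < e" "e < 1" "F e < \<delta>"
    by (rule eventually_at_right_less)
  have eb: "e < b"
  proof -
    have "e * (\<delta> / b) < \<delta>" using e(3) unfolding F_def by linarith
    then show ?thesis using b \<delta> by (simp add: field_simps)
  qed
  have e\<delta>: "\<bar>G e 1 - G 0 0\<bar> < \<delta>" "\<bar>G e (-1) - G 0 0\<bar> < \<delta>"
  proof -
    have "0 < e * (\<delta> / b)" using e b \<delta> by simp
    then show "\<bar>G e 1 - G 0 0\<bar> < \<delta>" "\<bar>G e (-1) - G 0 0\<bar> < \<delta>"
      using e(3) unfolding F_def by linarith+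
  qed
  have env: "power_envelope c b h = G 0 0" by (simp add: power_envelope_def G_def)
  let ?B = "\<lambda>n. {\<omega> \<in> space (P n). e \<le> \<bar>T n \<omega> - b\<bar>}"
  let ?m = "\<lambda>n. measure (P n)"
  have up: "(\<lambda>n. ?m n (A (b - e) n) + 1 - ?m n (A 0 n) + ?m n (?B n)) \<longlonglongrightarrow> G e (-1) + 0"
    unfolding G_def using A_prob[of "b - e"] A_prob[of 0] T_lim[OF e(1)]
    by (intro tendsto_add tendsto_diff) auto
  have lo: "(\<lambda>n. ?m n (A (b + e) n) + 1 - ?m n (A 0 n) - 2 * ?m n (?B n)) \<longlonglongrightarrow> G e 1 - 2 * 0"
    unfolding G_def using A_prob[of "b + e"] A_prob[of 0] T_lim[OF e(1)]
    by (intro tendsto_add tendsto_diff tendsto_mult_left) auto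
  have "\<forall>\<^sub>F n in sequentially. ?m n (A (b - e) n) + 1 - ?m n (A 0 n) + ?m n (?B n) < power_envelope c b h + \<delta>"
    by (rule order_tendstoD(2)[OF up]) (use e\<delta> env in linarith)
  moreover have "\<forall>\<^sub>F n in sequentially. power_envelope c b h - \<delta> < ?m n (A (b + e) n) + 1 - ?m n (A 0 n) - 2 * ?m n (?B n)"
    by (rule order_tendstoD(1)[OF lo]) (use e\<delta> env in linarith)
  ultimately have "\<forall>\<^sub>F n in sequentially. norm ((\<integral>\<omega>. \<phi> n \<omega> \<partial>P n) - power_envelope c b h) < \<delta>"
    using prob sandwich[OF e(1) eb]
  proof eventually_elim
    case (elim n)
    interpret prob_space "P n" using elim by simp
    have sp: "space (P n) = space (S n)" using elim by (metis sets_eq_imp_space_eq)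
    have A_s: "A u n \<in> sets (P n)" for u using elim A_sets by simp
    have [measurable]: "T n \<in> borel_measurable (P n)"
      using elim T[of n] by (auto cong: measurable_cong_sets)
    have [measurable]: "\<phi> n \<in> borel_measurable (P n)"
      using elim \<phi> by (auto simp: test_sequence_def cong: measurable_cong_sets)
    have \<phi>01: "0 \<le> \<phi> n \<omega> \<and> \<phi> n \<omega> \<le> 1" if "\<omega> \<in> space (P n)" for \<omega>
      using \<phi> that sp by (auto simp: test_sequence_def)
    have B_s: "?B n \<in> sets (P n)" by measurable
    have i: "integrable (P n) (\<phi> n)"
      by (rule integrable_const_bound[where B=1]) (use \<phi>01 in auto)
    have ind: "integrable (P n) (indicator E :: _ \<Rightarrow> real)" "(\<integral>\<omega>. indicator E \<omega> \<partial>P n) = ?m n E"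
      if "E \<in> sets (P n)" for E
      using that by (auto simp: sets.Int_space_eq2 less_top[symmetric] intro!: integrable_real_indicator)
    have "(\<integral>\<omega>. \<phi> n \<omega> \<partial>P n)
      \<le> (\<integral>\<omega>. indicator (A (b - e) n) \<omega> + 1 - indicator (A 0 n) \<omega> + indicator (?B n) \<omega> \<partial>P n)"
    proof (rule integral_mono[OF i])
      show "integrable (P n) (\<lambda>\<omega>. indicator (A (b - e) n) \<omega> + 1 - indicator (A 0 n) \<omega> + indicator (?B n) \<omega> :: real)"
        by (intro Bochner_Integration.integrable_add Bochner_Integration.integrable_diff ind A_s B_s) simp
      fix \<omega> assume \<omega>: "\<omega> \<in> space (P n)"
      show "\<phi> n \<omega> \<le> indicator (A (b - e) n) \<omega> + 1 - indicator (A 0 n) \<omega> + indicator (?B n) \<omega>"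
        using elim(4) \<phi>01[OF \<omega>] \<omega> sp
        by (cases "e \<le> \<bar>T n \<omega> - b\<bar>") (auto split: split_indicator)
    qed
    also have "\<dots> = ?m n (A (b - e) n) + 1 - ?m n (A 0 n) + ?m n (?B n)"
      using ind[OF A_s] ind[OF B_s] by (simp add: prob_space)
    finally have 1: "(\<integral>\<omega>. \<phi> n \<omega> \<partial>P n) \<le> \<dots>" .
    \<comment> \<open>The factor \<open>2\<close> makes the lower bound nonpositive on the bad event whatever the values of the indicators.\<close>
    have "(\<integral>\<omega>. indicator (A (b + e) n) \<omega> + 1 - indicator (A 0 n) \<omega> - 2 * indicator (?B n) \<omega> \<partial>P n)
      \<le> (\<integral>\<omega>. \<phi> n \<omega> \<partial>P n)"
    proof (rule integral_mono[OF _ i])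
      show "integrable (P n) (\<lambda>\<omega>. indicator (A (b + e) n) \<omega> + 1 - indicator (A 0 n) \<omega> - 2 * indicator (?B n) \<omega> :: real)"
        by (intro Bochner_Integration.integrable_add Bochner_Integration.integrable_diff
              integrable_mult_right ind A_s B_s) simp
      fix \<omega> assume \<omega>: "\<omega> \<in> space (P n)"
      show "indicator (A (b + e) n) \<omega> + 1 - indicator (A 0 n) \<omega> - 2 * indicator (?B n) \<omega> \<le> \<phi> n \<omega>"
        using elim(4) \<phi>01[OF \<omega>] \<omega> sp
        by (cases "e \<le> \<bar>T n \<omega> - b\<bar>") (auto split: split_indicator)
    qed
    also have "(\<integral>\<omega>. indicator (A (b + e) n) \<omega> + 1 - indicator (A 0 n) \<omega> - 2 * indicator (?B n) \<omega> \<partial>P n)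
      = ?m n (A (b + e) n) + 1 - ?m n (A 0 n) - 2 * ?m n (?B n)"
      using ind[OF A_s] ind[OF B_s] by (simp add: prob_space)
    finally show ?case using 1 elim by (simp add: abs_if)
  qed
  then show "\<exists>no. \<forall>n\<ge>no. norm ((\<integral>\<omega>. \<phi> n \<omega> \<partial>P n) - power_envelope c b h) < \<delta>"
    by (simp add: eventually_sequentially)
qed

section \<open>Asymptotics of a density with a moving boundary\<close>

text \<open>
  The model along the line \<open>{(\<theta>, \<gamma>)}\<close> through the true value, near \<open>\<theta>\<^sub>0\<close>. These are the consequences of the smoothness and
  moment conditions on which the asymptotics rest: \<open>slope x\<close> is the derivative of the boundary at \<open>\<theta>\<^sub>0\<close>, and \<open>S\<close> dominates the
  squared difference quotients of \<open>sqrt f\<close> in \<open>\<theta>\<close>, which are of the size of the squared score times the density. As \<open>S\<close> is going to be a supremum over an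
  uncountable set, its measurability is left open.
\<close>
locale regular_boundary_model =
  fixes Yset :: "real set" and p :: "(real ^ 'k::finite) pmf"
    and f :: "real \<Rightarrow> real ^ 'k \<Rightarrow> real \<times> (real ^ 'd::finite) \<Rightarrow> real"
    and g :: "real ^ 'k \<Rightarrow> real \<Rightarrow> real"
    and \<theta>0 :: real and \<gamma> :: "real ^ 'd" and \<delta> C :: real
    and slope :: "real ^ 'k \<Rightarrow> real" and S :: "real ^ 'k \<Rightarrow> real \<Rightarrow> ennreal"
  assumes finite_support: "finite (set_pmf p)"
    and Yset_borel: "Yset \<in> sets borel"
    and radius: "0 < \<delta>"
    and cond_density_measurable: "x \<in> set_pmf p \<Longrightarrow> \<bar>t - \<theta>0\<bar> < \<delta> \<Longrightarrow>
      cond_density Yset f g x (t, \<gamma>) \<in> borel_measurable borel"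
    and cond_density_mass: "x \<in> set_pmf p \<Longrightarrow> \<bar>t - \<theta>0\<bar> < \<delta> \<Longrightarrow>
      (\<integral>\<^sup>+ y. ennreal (cond_density Yset f g x (t, \<gamma>) y) \<partial>lborel) = 1"
    and f_pos: "x \<in> set_pmf p \<Longrightarrow> \<bar>t - \<theta>0\<bar> < \<delta> \<Longrightarrow> y \<in> Yset \<Longrightarrow> 0 < f y x (t, \<gamma>)"
    and f_continuous: "x \<in> set_pmf p \<Longrightarrow> continuous_on Yset (\<lambda>y. f y x (\<theta>0, \<gamma>))"
    and f_lipschitz: "x \<in> set_pmf p \<Longrightarrow> \<bar>t - \<theta>0\<bar> < \<delta> \<Longrightarrow> y \<in> Yset \<Longrightarrow>
      \<bar>f y x (t, \<gamma>) - f y x (\<theta>0, \<gamma>)\<bar> \<le> C * \<bar>t - \<theta>0\<bar>"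
    and sqrt_f_lipschitz: "x \<in> set_pmf p \<Longrightarrow> \<bar>t - \<theta>0\<bar> < \<delta> \<Longrightarrow> \<bar>u - \<theta>0\<bar> < \<delta> \<Longrightarrow> t < u \<Longrightarrow>
      y \<in> Yset \<Longrightarrow> g x u \<le> y \<Longrightarrow>
      ennreal ((sqrt (f y x (u, \<gamma>)) - sqrt (f y x (t, \<gamma>)))\<^sup>2 / (u - t)\<^sup>2) \<le> S x y"
    and score_integrable: "x \<in> set_pmf p \<Longrightarrow> (\<integral>\<^sup>+ y\<in>Yset. S x y \<partial>lborel) < \<infinity>"
    and g_mem: "x \<in> set_pmf p \<Longrightarrow> \<bar>t - \<theta>0\<bar> < \<delta> \<Longrightarrow> g x t \<in> Yset"
    and g_strict_mono: "x \<in> set_pmf p \<Longrightarrow> \<bar>t - \<theta>0\<bar> < \<delta> \<Longrightarrow> \<bar>u - \<theta>0\<bar> < \<delta> \<Longrightarrow> t < u \<Longrightarrow>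
      g x t < g x u"
    and g_continuous: "x \<in> set_pmf p \<Longrightarrow> continuous_on {\<theta>0 - \<delta> <..< \<theta>0 + \<delta>} (g x)"
    and g_deriv: "x \<in> set_pmf p \<Longrightarrow> (g x has_real_derivative slope x) (at \<theta>0)"
    and slope_pos: "x \<in> set_pmf p \<Longrightarrow> 0 < slope x"
begin

definition base :: "'k obs measure"
  where "base = lborel \<Otimes>\<^sub>M count_space (set_pmf p)"

definition dens :: "real \<Rightarrow> 'k obs \<Rightarrow> real"
  where "dens t = (\<lambda>(y, x). pmf p x * cond_density Yset f g x (t, \<gamma>) y)"

definition tail :: "real \<Rightarrow> 'k obs set"
  where "tail u = {z \<in> space base. g (snd z) u \<le> fst z}"

text \<open>
  The rate at which observations accumulate at the boundary: \<open>rate / n\<close> is the probability, to first order, that an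
  observation falls between the boundaries of \<open>\<theta>\<^sub>0\<close> and \<open>\<theta>\<^sub>0 + 1 / n\<close>. It is \<open>1 / \<lambda>\<close>.
\<close>
definition rate :: real
  where "rate = measure_pmf.expectation p (\<lambda>x. f (g x \<theta>0) x (\<theta>0, \<gamma>) * slope x)"

definition all_above :: "real \<Rightarrow> nat \<Rightarrow> 'k sample set"
  where "all_above u n = {\<omega> \<in> space (sample_space p n). \<forall>i<n. g (snd (\<omega> i)) (\<theta>0 + u / real n) \<le> fst (\<omega> i)}"

lemma rate_eq: "rate = (\<Sum>x\<in>set_pmf p. pmf p x * (f (g x \<theta>0) x (\<theta>0, \<gamma>) * slope x))"
  unfolding rate_def using finite_support by (subst integral_measure_pmf) (auto simp: mult.commute)

lemma rate_pos: "0 < rate"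
proof -
  have "0 < f (g x \<theta>0) x (\<theta>0, \<gamma>) * slope x" if "x \<in> set_pmf p" for x
    using that radius by (intro mult_pos_pos f_pos g_mem slope_pos) auto
  then show ?thesis
    unfolding rate_eq
    by (intro sum_pos finite_support set_pmf_not_empty) (auto simp: pmf_positive)
qed

lemma g_mono: "x \<in> set_pmf p \<Longrightarrow> \<bar>t - \<theta>0\<bar> < \<delta> \<Longrightarrow> \<bar>u - \<theta>0\<bar> < \<delta> \<Longrightarrow> t \<le> u \<Longrightarrow> g x t \<le> g x u"
  using g_strict_mono[of x t u] by (cases "t = u") auto

lemma eventually_near: "\<forall>\<^sub>F n in sequentially. \<bar>(\<theta>0 + h / real n) - \<theta>0\<bar> < \<delta>"
proof -
  have "(\<lambda>n. \<bar>h / real n\<bar>) \<longlonglongrightarrow> \<bar>0\<bar>"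
    by (intro tendsto_rabs lim_const_over_n)
  then have "\<forall>\<^sub>F n in sequentially. \<bar>h / real n\<bar> < \<delta>"
    by (rule order_tendstoD) (use radius in simp)
  then show ?thesis by simp
qed

lemma sigma_finite_base: "sigma_finite_measure base"
proof -
  interpret pair_sigma_finite lborel "count_space (set_pmf p)"
    by (intro pair_sigma_finite.intro sigma_finite_measure_count_space_finite finite_support)
      unfold_locales
  show ?thesis unfolding base_def by unfold_locales
qed

lemma space_base: "space base = UNIV \<times> set_pmf p"
  by (simp add: base_def space_pair_measure)

text \<open>
  As \<open>X\<close> has finite support, measurability and integrals over \<open>(y, x)\<close> reduce to those of the sections at each
  support point.
\<close>
lemma measurable_base:
  assumes "\<And>x. x \<in> set_pmf p \<Longrightarrow> (\<lambda>y. F (y, x)) \<in> borel_measurable borel"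
  shows "F \<in> borel_measurable base"
proof -
  have "(\<lambda>(x, y). F (y, x)) \<in> borel_measurable (count_space (set_pmf p) \<Otimes>\<^sub>M lborel)"
    using assms finite_support
    by (intro measurable_pair_measure_countable1) (auto simp: countable_finite)
  then show ?thesis
    unfolding base_def by (subst measurable_pair_swap_iff) (simp add: case_prod_unfold)
qed

lemma nn_integral_base:
  assumes "F \<in> borel_measurable base"
  shows "(\<integral>\<^sup>+ z. F z \<partial>base) = (\<Sum>x\<in>set_pmf p. \<integral>\<^sup>+ y. F (y, x) \<partial>lborel)"
proof -
  interpret pair_sigma_finite lborel "count_space (set_pmf p)"
    by (intro pair_sigma_finite.intro sigma_finite_measure_count_space_finite finite_support)
      unfold_locales
  have "(\<integral>\<^sup>+ z. F z \<partial>base) = (\<integral>\<^sup>+ x. (\<integral>\<^sup>+ y. F (y, x) \<partial>lborel) \<partial>count_space (set_pmf p))"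
    using assms nn_integral_snd[of F] by (simp add: base_def)
  then show ?thesis
    by (simp add: nn_integral_count_space_finite finite_support)
qed

lemma integral_base:
  fixes F :: "'k obs \<Rightarrow> real"
  assumes "integrable base F"
  shows "(\<integral> z. F z \<partial>base) = (\<Sum>x\<in>set_pmf p. \<integral> y. F (y, x) \<partial>lborel)"
proof -
  interpret pair_sigma_finite lborel "count_space (set_pmf p)"
    by (intro pair_sigma_finite.intro sigma_finite_measure_count_space_finite finite_support)
      unfold_locales
  have "(\<integral> z. F z \<partial>base) = (\<integral> x. (\<integral> y. F (y, x) \<partial>lborel) \<partial>count_space (set_pmf p))"
    using assms integral_snd[of "\<lambda>y x. F (y, x)"] by (simp add: base_def)
  then show ?thesis
    by (simp add: lebesgue_integral_count_space_finite finite_support)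
qed

lemma tail_sets: "tail u \<in> sets base"
proof -
  have [measurable]: "(\<lambda>z. g (snd z) u) \<in> borel_measurable base"
    unfolding base_def by (rule measurable_compose[OF measurable_snd]) simp
  have [measurable]: "fst \<in> borel_measurable base"
    unfolding base_def using measurable_fst[of lborel] by simp
  show ?thesis unfolding tail_def by measurable
qed

lemma cond_density_nonneg:
  "x \<in> set_pmf p \<Longrightarrow> \<bar>t - \<theta>0\<bar> < \<delta> \<Longrightarrow> 0 \<le> cond_density Yset f g x (t, \<gamma>) y"
  using f_pos[of x t y] by (auto simp: cond_density_def split: split_indicator)

context
  fixes t :: real
  assumes t: "\<bar>t - \<theta>0\<bar> < \<delta>"
begin

lemma dens_nonneg: "0 \<le> dens t z"
  using cond_density_nonneg[of "snd z" t "fst z"] t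
  by (cases "snd z \<in> set_pmf p") (auto simp: dens_def case_prod_unfold set_pmf_iff)

lemma dens_measurable: "dens t \<in> borel_measurable base"
  using cond_density_measurable[OF _ t] by (intro measurable_base) (simp add: dens_def)

lemma dens_mass: "(\<integral>\<^sup>+ z. ennreal (dens t z) \<partial>base) = 1"
proof -
  have "(\<integral>\<^sup>+ z. ennreal (dens t z) \<partial>base)
      = (\<Sum>x\<in>set_pmf p. \<integral>\<^sup>+ y. ennreal (pmf p x) * ennreal (cond_density Yset f g x (t, \<gamma>) y) \<partial>lborel)"
    using dens_measurable cond_density_nonneg t
    by (subst nn_integral_base) (auto simp: dens_def ennreal_mult)
  also have "\<dots> = (\<Sum>x\<in>set_pmf p. ennreal (pmf p x))"
    using cond_density_mass[OF _ t] cond_density_measurable[OF _ t]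
    by (intro sum.cong) (simp_all add: nn_integral_cmult)
  also have "\<dots> = 1"
    using finite_support sum_pmf_eq_1[of "set_pmf p" p] by (simp add: sum_ennreal)
  finally show ?thesis .
qed

lemma dens_integrable: "integrable base (dens t)"
  using dens_measurable dens_nonneg dens_mass by (intro integrableI_nonneg) auto

lemma dens_integral: "(\<integral> z. dens t z \<partial>base) = 1"
  using dens_measurable dens_nonneg dens_mass by (simp add: integral_eq_nn_integral)

lemma obs_law_eq: "obs_law Yset p f g (t, \<gamma>) = density base (\<lambda>z. ennreal (dens t z))"
  by (simp add: obs_law_def base_def dens_def case_prod_unfold)

lemma prob_space_obs_law: "prob_space (obs_law Yset p f g (t, \<gamma>))"
  unfolding obs_law_eq using dens_measurable dens_mass
  by (intro prob_spaceI) (simp add: emeasure_density cong: nn_integral_cong)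

lemma measure_obs_law_tail:
  "measure (obs_law Yset p f g (t, \<gamma>)) (tail u) = (\<integral> z. dens t z * indicator (tail u) z \<partial>base)"
  unfolding obs_law_eq using dens_measurable dens_nonneg tail_sets
  by (simp add: measure_def emeasure_density integral_eq_nn_integral ennreal_mult'' ennreal_indicator)

end

lemma sets_sample_law: "sets (sample_law Yset p f g \<beta> n) = sets (sample_space p n)"
  unfolding sample_law_def sample_space_def obs_law_def
  by (intro sets_PiM_cong) (auto intro!: sets_pair_measure_cong)

lemma sets_local_law: "sets (local_law Yset p f g \<theta>0 \<gamma> h n) = sets (sample_space p n)"
  by (simp add: local_law_def sets_sample_law)

lemma eventually_prob_space:
  "\<forall>\<^sub>F n in sequentially. prob_space (local_law Yset p f g \<theta>0 \<gamma> h n)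
    \<and> sets (local_law Yset p f g \<theta>0 \<gamma> h n) = sets (sample_space p n)"
  using eventually_near[of h]
  by eventually_elim
    (simp add: sets_local_law, auto simp: local_law_def sample_law_def intro!: prob_space_PiM prob_space_obs_law)

lemma all_above_eq: "all_above u n = Pi\<^sub>E {..<n} (\<lambda>_. tail (\<theta>0 + u / real n))"
  by (auto simp: all_above_def tail_def sample_space_def space_PiM space_base space_pair_measure PiE_def Pi_def)

lemma all_above_sets: "all_above u n \<in> sets (sample_space p n)"
proof -
  have "sets base = sets (borel \<Otimes>\<^sub>M count_space (set_pmf p))"
    unfolding base_def by (intro sets_pair_measure_cong) auto
  then show ?thesis
    unfolding all_above_eq sample_space_def using tail_sets by (intro sets_PiM_I_finite) auto
qed

lemma measure_all_above:
  assumes "\<bar>(\<theta>0 + h / real n) - \<theta>0\<bar> < \<delta>"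
  shows "measure (local_law Yset p f g \<theta>0 \<gamma> h n) (all_above u n)
    = (\<integral> z. dens (\<theta>0 + h / real n) z * indicator (tail (\<theta>0 + u / real n)) z \<partial>base) ^ n"
proof -
  let ?O = "obs_law Yset p f g (\<theta>0 + h / real n, \<gamma>)"
  interpret O: prob_space ?O by (rule prob_space_obs_law[OF assms])
  interpret finite_product_prob_space "\<lambda>_. ?O" "{..<n}" by unfold_locales simp
  have "tail v \<in> sets ?O" for v using tail_sets by (simp add: obs_law_eq[OF assms])
  then show ?thesis
    unfolding all_above_eq local_law_def sample_law_def
    by (subst prob_times) (auto simp: measure_obs_law_tail[OF assms])
qed

text \<open>
  The mass between the boundaries of \<open>h1\<close> and \<open>h2\<close> is the gap \<open>g x t\<^sub>2 - g x t\<^sub>1\<close>, about \<open>slope x * (h2 - h1) / n\<close>, times a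
  density value that approaches \<open>f (g x \<theta>0) x (\<theta>0, \<gamma>)\<close>. Every point of the gap is a boundary value \<open>g x s\<close> by the intermediate value
  theorem, so it belongs to \<open>Yset\<close>, where \<open>f\<close> is positive and continuous.
\<close>
lemma below_integral_tendsto:
  assumes x: "x \<in> set_pmf p" and h: "h1 < h2"
  shows "(\<lambda>n. real n * (\<integral> y. cond_density Yset f g x (\<theta>0 + h1 / real n, \<gamma>) y
        * indicator {..<g x (\<theta>0 + h2 / real n)} y \<partial>lborel))
    \<longlonglongrightarrow> f (g x \<theta>0) x (\<theta>0, \<gamma>) * slope x * (h2 - h1)"
proof -
  define t where "t h n = \<theta>0 + h / real n" for h and n :: nat
  define F0 where "F0 = f (g x \<theta>0) x (\<theta>0, \<gamma>)"
  define J where "J n = (\<integral> y. cond_density Yset f g x (t h1 n, \<gamma>) y * indicator {..<g x (t h2 n)} y \<partial>lborel)" for n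
  define w where "w n = g x (t h2 n) - g x (t h1 n)" for n
  have t_lim: "(\<lambda>n. t h n) \<longlonglongrightarrow> \<theta>0" for h
    unfolding t_def using tendsto_add[OF tendsto_const lim_const_over_n, of \<theta>0 h] by simp
  have g_incr: "(\<lambda>n. real n * (g x (t h n) - g x \<theta>0)) \<longlonglongrightarrow> slope x * h" for h
  proof (cases "h = 0")
    case False
    have ev: "\<forall>\<^sub>F n in sequentially. t h n \<noteq> \<theta>0"
      using eventually_gt_at_top[of 0] by eventually_elim (simp add: t_def False)
    have "((\<lambda>s. (g x s - g x \<theta>0) / (s - \<theta>0)) \<longlongrightarrow> slope x) (at \<theta>0)"
      using g_deriv[OF x] by (simp add: has_field_derivative_iff)
    moreover have "filterlim (t h) (at \<theta>0) sequentially"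
      using t_lim ev by (simp add: filterlim_at)
    ultimately have "(\<lambda>n. (g x (t h n) - g x \<theta>0) / (t h n - \<theta>0)) \<longlonglongrightarrow> slope x"
      by (rule filterlim_compose)
    then have "(\<lambda>n. (g x (t h n) - g x \<theta>0) / (t h n - \<theta>0) * h) \<longlonglongrightarrow> slope x * h"
      by (intro tendsto_mult tendsto_const)
    moreover have "\<forall>\<^sub>F n in sequentially. (g x (t h n) - g x \<theta>0) / (t h n - \<theta>0) * h
        = real n * (g x (t h n) - g x \<theta>0)"
      using eventually_gt_at_top[of 0] by eventually_elim (simp add: t_def False)
    ultimately show ?thesis by (simp add: tendsto_cong)
  qed (simp add: t_def)
  have w_lim: "(\<lambda>n. real n * w n) \<longlonglongrightarrow> slope x * (h2 - h1)"
    using tendsto_diff[OF g_incr[of h2] g_incr[of h1]] by (simp add: w_def algebra_simps)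
  have "(\<lambda>n. real n * (J n - F0 * w n)) \<longlonglongrightarrow> 0"
  proof (rule LIMSEQ_I)
    fix \<epsilon> :: real assume \<epsilon>: "0 < \<epsilon>"
    define W where "W = slope x * (h2 - h1) + 1"
    have W: "0 < W" using slope_pos[OF x] h by (simp add: W_def add_pos_pos)
    \<comment> \<open>\<open>W\<close> exceeds the limit of \<open>n * w n\<close>; an error of \<open>2 * e\<close> in the density then contributes at most \<open>2 * e * W < \<epsilon>\<close>.\<close>
    define e where "e = \<epsilon> / (4 * W)"
    have e: "0 < e" using \<epsilon> W by (simp add: e_def)
    have "g x \<theta>0 \<in> Yset" using g_mem[OF x] radius by simp
    then obtain d where d: "0 < d"
      "\<And>y. y \<in> Yset \<Longrightarrow> dist y (g x \<theta>0) < d \<Longrightarrow> dist (f y x (\<theta>0, \<gamma>)) F0 < e"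
      using f_continuous[OF x] e unfolding continuous_on_iff F0_def by metis
    have gc: "(\<lambda>n. g x (t h n)) \<longlonglongrightarrow> g x \<theta>0" for h
      by (rule isCont_tendsto_compose[OF DERIV_isCont[OF g_deriv[OF x]] t_lim])
    have g_near: "\<forall>\<^sub>F n in sequentially. dist (g x (t h n)) (g x \<theta>0) < d" for h
      using gc d(1) by (rule tendstoD)
    have "(\<lambda>n. C * \<bar>t h1 n - \<theta>0\<bar>) \<longlonglongrightarrow> C * \<bar>\<theta>0 - \<theta>0\<bar>"
      by (intro tendsto_intros t_lim)
    then have lip: "\<forall>\<^sub>F n in sequentially. C * \<bar>t h1 n - \<theta>0\<bar> < e"
      by (rule order_tendstoD) (use e in simp)
    have near: "\<forall>\<^sub>F n in sequentially. \<bar>t h n - \<theta>0\<bar> < \<delta>" for h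
      using eventually_near[of h] by (simp add: t_def)
    have wW: "\<forall>\<^sub>F n in sequentially. real n * w n < W"
      by (rule order_tendstoD[OF w_lim]) (simp add: W_def)
    have "\<forall>\<^sub>F n in sequentially. norm (real n * (J n - F0 * w n) - 0) < \<epsilon>"
      using g_near[of h1] g_near[of h2] lip near[of h1] near[of h2] wW eventually_gt_at_top[of 0]
    proof eventually_elim
      case (elim n)
      let ?a = "g x (t h1 n)" and ?b = "g x (t h2 n)"
      have t12: "t h1 n < t h2 n"
        using h elim by (simp add: t_def divide_strict_right_mono)
      have ab: "?a < ?b" using g_strict_mono[OF x] t12 elim by simp
      have close: "\<bar>f y x (t h1 n, \<gamma>) - F0\<bar> \<le> 2 * e \<and> y \<in> Yset" if y: "?a \<le> y" "y \<le> ?b" for y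
      proof -
        have "continuous_on {t h1 n..t h2 n} (g x)"
          using elim by (intro continuous_on_subset[OF g_continuous[OF x]]) auto
        then obtain s where s: "t h1 n \<le> s" "s \<le> t h2 n" "g x s = y"
          using IVT'[of "g x" "t h1 n" y "t h2 n"] y t12 by auto
        then have Y: "y \<in> Yset" using g_mem[OF x, of s] elim by auto
        moreover have "dist y (g x \<theta>0) < d" using elim y by (auto simp: dist_real_def)
        ultimately have "\<bar>f y x (\<theta>0, \<gamma>) - F0\<bar> < e" using d(2)[of y] by (simp add: dist_real_def)
        moreover have "\<bar>f y x (t h1 n, \<gamma>) - f y x (\<theta>0, \<gamma>)\<bar> < e"
          using f_lipschitz[OF x _ Y, of "t h1 n"] elim by linarith
        ultimately show ?thesis using Y by linarith
      qed
      let ?k = "\<lambda>y. cond_density Yset f g x (t h1 n, \<gamma>) y * indicator {..<?b} y"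
      have k: "?k y = (if y \<in> {?a..<?b} then f y x (t h1 n, \<gamma>) else 0)" for y
        using close[of y] by (auto simp: cond_density_def split: split_indicator)
      have ic: "integrable lborel (\<lambda>y. c * indicator {?a..<?b} y)"
        "(\<integral> y. c * indicator {?a..<?b} y \<partial>lborel) = c * w n" for c :: real
        using ab by (auto simp: w_def)
      have [measurable]: "cond_density Yset f g x (t h1 n, \<gamma>) \<in> borel_measurable borel"
        using cond_density_measurable[OF x] elim by simp
      have ik: "integrable lborel ?k"
      proof (rule Bochner_Integration.integrable_bound[OF ic(1)[of "\<bar>F0\<bar> + 2 * e"]])
        show "?k \<in> borel_measurable lborel" by measurable
        show "AE y in lborel. norm (?k y) \<le> norm ((\<bar>F0\<bar> + 2 * e) * indicator {?a..<?b} y)"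
        proof (rule AE_I2)
          fix y show "norm (?k y) \<le> norm ((\<bar>F0\<bar> + 2 * e) * indicator {?a..<?b} y)"
            unfolding k using close[of y] e by (auto split: split_indicator)
        qed
      qed
      have "J n \<le> (F0 + 2 * e) * w n"
        unfolding J_def ic(2)[symmetric]
      proof (rule integral_mono[OF ik ic(1)])
        fix y show "?k y \<le> (F0 + 2 * e) * indicator {?a..<?b} y"
          unfolding k using close[of y] e by (auto split: split_indicator)
      qed
      moreover have "(F0 - 2 * e) * w n \<le> J n"
        unfolding J_def ic(2)[symmetric]
      proof (rule integral_mono[OF ic(1) ik])
        fix y show "(F0 - 2 * e) * indicator {?a..<?b} y \<le> ?k y"
          unfolding k using close[of y] e by (auto split: split_indicator)
      qed
      ultimately have "\<bar>J n - F0 * w n\<bar> \<le> 2 * e * w n"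
        by (simp add: algebra_simps abs_if)
      then have "real n * \<bar>J n - F0 * w n\<bar> \<le> real n * (2 * e * w n)"
        by (intro mult_left_mono) auto
      also have "\<dots> = 2 * e * (real n * w n)" by simp
      also have "\<dots> \<le> 2 * e * W" using elim e by (intro mult_left_mono) auto
      also have "\<dots> < \<epsilon>" using \<epsilon> W by (simp add: e_def)
      finally show ?case by (simp add: abs_mult)
    qed
    then show "\<exists>no. \<forall>n\<ge>no. norm (real n * (J n - F0 * w n) - 0) < \<epsilon>"
      by (simp add: eventually_sequentially)
  qed
  from tendsto_add[OF this tendsto_mult_left[OF w_lim, of F0]]
  have "(\<lambda>n. real n * J n) \<longlonglongrightarrow> F0 * (slope x * (h2 - h1))"
    by (simp add: algebra_simps)
  then show ?thesis
    by (simp add: J_def t_def F0_def mult.assoc)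
qed

text \<open>
  Mass and Hellinger affinity refer to the density at \<open>t\<close> cut down to the support at \<open>u\<close>, without renormalization: the lost
  mass is what produces the exponential limit.
\<close>
definition survival :: "real \<Rightarrow> real \<Rightarrow> real"
  where "survival t u = (\<integral> z. dens t z * indicator (tail u) z \<partial>base)"

definition affinity :: "real \<Rightarrow> real \<Rightarrow> real"
  where "affinity t u = (\<integral> z. sqrt (dens u z * (dens t z * indicator (tail u) z)) \<partial>base)"

lemma dens_tail_integrable:
  assumes "\<bar>t - \<theta>0\<bar> < \<delta>"
  shows "integrable base (\<lambda>z. dens t z * indicator (tail u) z)"
  using integrable_mult_indicator[OF tail_sets dens_integrable[OF assms]] by (simp add: mult.commute)

lemma survival_deficit:
  assumes t: "\<bar>t - \<theta>0\<bar> < \<delta>"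
  shows "1 - survival t u = (\<Sum>x\<in>set_pmf p. pmf p x *
    (\<integral> y. cond_density Yset f g x (t, \<gamma>) y * indicator {..<g x u} y \<partial>lborel))"
proof -
  let ?B = "\<lambda>z. dens t z * indicator {..<g (snd z) u} (fst z)"
  have split: "?B z = dens t z - dens t z * indicator (tail u) z" if "z \<in> space base" for z
    using that by (auto simp: tail_def split: split_indicator)
  have "integrable base (\<lambda>z. dens t z - dens t z * indicator (tail u) z)"
    using dens_integrable[OF t] dens_tail_integrable[OF t] by simp
  then have int: "integrable base ?B"
    using split by (simp cong: Bochner_Integration.integrable_cong)
  have "1 - survival t u = (\<integral> z. dens t z - dens t z * indicator (tail u) z \<partial>base)"
    using dens_integrable[OF t] dens_tail_integrable[OF t] dens_integral[OF t]
    by (simp add: survival_def)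
  also have "\<dots> = (\<integral> z. ?B z \<partial>base)"
    using split by (intro Bochner_Integration.integral_cong) auto
  also have "\<dots> = (\<Sum>x\<in>set_pmf p. \<integral> y. ?B (y, x) \<partial>lborel)"
    by (rule integral_base[OF int])
  finally show ?thesis by (simp add: dens_def mult.assoc)
qed

lemma survival_deficit_tendsto:
  assumes h: "h1 < h2"
  shows "(\<lambda>n. real n * (1 - survival (\<theta>0 + h1 / real n) (\<theta>0 + h2 / real n)))
    \<longlonglongrightarrow> rate * (h2 - h1)"
proof -
  have "(\<lambda>n. \<Sum>x\<in>set_pmf p. pmf p x * (real n * (\<integral> y. cond_density Yset f g x (\<theta>0 + h1 / real n, \<gamma>) y
        * indicator {..<g x (\<theta>0 + h2 / real n)} y \<partial>lborel)))
    \<longlonglongrightarrow> (\<Sum>x\<in>set_pmf p. pmf p x * (f (g x \<theta>0) x (\<theta>0, \<gamma>) * slope x * (h2 - h1)))"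
    using h by (intro tendsto_sum tendsto_mult_left below_integral_tendsto)
  also have "(\<Sum>x\<in>set_pmf p. pmf p x * (f (g x \<theta>0) x (\<theta>0, \<gamma>) * slope x * (h2 - h1))) = rate * (h2 - h1)"
    by (simp add: rate_eq sum_distrib_right mult.assoc)
  finally have lim: "(\<lambda>n. \<Sum>x\<in>set_pmf p. pmf p x * (real n * (\<integral> y. cond_density Yset f g x (\<theta>0 + h1 / real n, \<gamma>) y
        * indicator {..<g x (\<theta>0 + h2 / real n)} y \<partial>lborel))) \<longlonglongrightarrow> rate * (h2 - h1)" .
  have "\<forall>\<^sub>F n in sequentially. (\<Sum>x\<in>set_pmf p. pmf p x * (real n * (\<integral> y. cond_density Yset f g x (\<theta>0 + h1 / real n, \<gamma>) y
        * indicator {..<g x (\<theta>0 + h2 / real n)} y \<partial>lborel)))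
      = real n * (1 - survival (\<theta>0 + h1 / real n) (\<theta>0 + h2 / real n))"
    using eventually_near[of h1]
    by eventually_elim (simp add: survival_deficit sum_distrib_left mult.left_commute)
  with lim show ?thesis by (simp add: tendsto_cong)
qed

text \<open>
  \<open>1 + survival t u - 2 * affinity t u\<close> is the integral of the squared difference of the two square-root densities. Both live
  on the support at \<open>u\<close>, because the boundary increases, and there \<open>S\<close> bounds the squared difference
  quotient. The discontinuity at the boundary, which is of order \<open>u - t\<close> in mass, has been removed by the restriction;
  what remains is quadratic, and so disappears after multiplication by \<open>n\<close>.
\<close>
lemma hellinger_bound:
  obtains K :: real where "\<And>t u. \<bar>t - \<theta>0\<bar> < \<delta> \<Longrightarrow> \<bar>u - \<theta>0\<bar> < \<delta> \<Longrightarrow> t < u \<Longrightarrow>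
    \<bar>1 + survival t u - 2 * affinity t u\<bar> \<le> K * (u - t)\<^sup>2"
proof
  define K where "K = (\<Sum>x\<in>set_pmf p. \<integral>\<^sup>+ y\<in>Yset. S x y \<partial>lborel)"
  have K: "K < \<infinity>" unfolding K_def using score_integrable by (simp add: finite_support)
  fix t u assume t: "\<bar>t - \<theta>0\<bar> < \<delta>" and u: "\<bar>u - \<theta>0\<bar> < \<delta>" and tu: "t < u"
  let ?r = "\<lambda>z. dens t z * indicator (tail u) z"
  let ?D = "\<lambda>z. (sqrt (dens u z) - sqrt (?r z))\<^sup>2"
  note [measurable] = dens_measurable[OF t] dens_measurable[OF u] tail_sets
  have nonneg: "0 \<le> dens u z" "0 \<le> ?r z" for z
    using dens_nonneg[OF t] dens_nonneg[OF u] by auto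
  note ints = dens_integrable[OF u] dens_tail_integrable[OF t, of u]
  have ia: "integrable base (\<lambda>z. sqrt (dens u z * ?r z))"
  proof (rule Bochner_Integration.integrable_bound)
    show "integrable base (\<lambda>z. dens u z + ?r z)" using ints by simp
    have "sqrt (dens u z * ?r z) \<le> dens u z + ?r z" for z
      using arith_geo_mean_sqrt[of "dens u z" "?r z"] nonneg[of z] by simp
    then show "AE z in base. norm (sqrt (dens u z * ?r z)) \<le> norm (dens u z + ?r z)"
      using nonneg by (simp add: add_nonneg_nonneg)
  qed measurable
  have D: "?D z = dens u z + ?r z - 2 * sqrt (dens u z * ?r z)" for z
    using nonneg[of z] real_sqrt_mult[of "dens u z" "?r z"]
    by (simp only: power2_diff real_sqrt_pow2 mult.assoc)
  have ID: "integrable base ?D" "(\<integral>z. ?D z \<partial>base) = 1 + survival t u - 2 * affinity t u"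
    unfolding D using ints ia dens_integral[OF u] by (simp_all add: survival_def affinity_def)
  have pointwise: "ennreal (?D (y, x) / (u - t)\<^sup>2) \<le> S x y * indicator Yset y"
    if x: "x \<in> set_pmf p" for x y
  proof (cases "y \<in> Yset \<and> g x u \<le> y")
    case True
    have gt: "g x t \<le> y" using True g_strict_mono[OF x t u tu] by linarith
    have eq: "?D (y, x) = pmf p x * (sqrt (f y x (u, \<gamma>)) - sqrt (f y x (t, \<gamma>)))\<^sup>2"
      using True gt x
      by (simp add: dens_def cond_density_def tail_def space_base real_sqrt_mult
          flip: right_diff_distrib add: power_mult_distrib)
    have "?D (y, x) / (u - t)\<^sup>2 \<le> (sqrt (f y x (u, \<gamma>)) - sqrt (f y x (t, \<gamma>)))\<^sup>2 / (u - t)\<^sup>2"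
      unfolding eq by (intro divide_right_mono mult_left_le_one_le) (auto simp: pmf_le_1)
    then have "ennreal (?D (y, x) / (u - t)\<^sup>2) \<le> S x y"
      using sqrt_f_lipschitz[OF x t u tu, of y] True by (meson ennreal_leI order_trans)
    then show ?thesis using True by simp
  next
    case False
    then have zero: "dens u (y, x) = 0" "?r (y, x) = 0"
      by (auto simp: dens_def cond_density_def tail_def split: split_indicator)
    show ?thesis unfolding zero by simp
  qed
  \<comment> \<open>The factor \<open>(u - t)\<^sup>2\<close> is moved out of an integral on this side, where the integrand is measurable.\<close>
  have "(\<integral>\<^sup>+ z. ennreal (?D z / (u - t)\<^sup>2) \<partial>base)
    = (\<Sum>x\<in>set_pmf p. \<integral>\<^sup>+ y. ennreal (?D (y, x) / (u - t)\<^sup>2) \<partial>lborel)"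
    by (rule nn_integral_base) measurable
  also have "\<dots> \<le> K"
    unfolding K_def using pointwise by (intro sum_mono nn_integral_mono)
  also have "K = ennreal (enn2real K)" using K by (simp add: less_top)
  finally have "enn2real (\<integral>\<^sup>+ z. ennreal (?D z / (u - t)\<^sup>2) \<partial>base) \<le> enn2real K"
    by (intro enn2real_leI) auto
  then have "(\<integral>z. ?D z / (u - t)\<^sup>2 \<partial>base) \<le> enn2real K"
    by (subst integral_eq_nn_integral) auto
  then have "(\<integral>z. ?D z \<partial>base) \<le> enn2real K * (u - t)\<^sup>2"
    using tu by (simp add: field_simps)
  moreover have "0 \<le> (\<integral>z. ?D z \<partial>base)" by (intro integral_nonneg_AE) simp
  ultimately show "\<bar>1 + survival t u - 2 * affinity t u\<bar> \<le> enn2real K * (u - t)\<^sup>2"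
    by (simp add: ID)
qed

lemma affinity_deficit_tendsto:
  assumes h: "h1 < h2"
  shows "(\<lambda>n. real n * (1 - affinity (\<theta>0 + h1 / real n) (\<theta>0 + h2 / real n)))
    \<longlonglongrightarrow> rate * (h2 - h1) / 2"
proof -
  let ?s = "\<lambda>n. survival (\<theta>0 + h1 / real n) (\<theta>0 + h2 / real n)"
  let ?a = "\<lambda>n. affinity (\<theta>0 + h1 / real n) (\<theta>0 + h2 / real n)"
  obtain K where K: "\<And>t u. \<bar>t - \<theta>0\<bar> < \<delta> \<Longrightarrow> \<bar>u - \<theta>0\<bar> < \<delta> \<Longrightarrow> t < u \<Longrightarrow>
    \<bar>1 + survival t u - 2 * affinity t u\<bar> \<le> K * (u - t)\<^sup>2"
    using hellinger_bound by blast
  have "(\<lambda>n. real n * (1 + ?s n - 2 * ?a n)) \<longlonglongrightarrow> 0"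
  proof (rule Lim_null_comparison)
    show "(\<lambda>n. K * (h2 - h1)\<^sup>2 / real n) \<longlonglongrightarrow> 0" by (rule lim_const_over_n)
    show "\<forall>\<^sub>F n in sequentially. norm (real n * (1 + ?s n - 2 * ?a n)) \<le> K * (h2 - h1)\<^sup>2 / real n"
      using eventually_near[of h1] eventually_near[of h2] eventually_gt_at_top[of 0]
    proof eventually_elim
      case (elim n)
      have "\<theta>0 + h1 / real n < \<theta>0 + h2 / real n"
        using elim h by (simp add: divide_strict_right_mono)
      then have "\<bar>1 + ?s n - 2 * ?a n\<bar> \<le> K * (\<theta>0 + h2 / real n - (\<theta>0 + h1 / real n))\<^sup>2"
        using elim by (intro K)
      also have "\<theta>0 + h2 / real n - (\<theta>0 + h1 / real n) = (h2 - h1) / real n"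
        by (simp add: diff_divide_distrib)
      finally have "real n * \<bar>1 + ?s n - 2 * ?a n\<bar> \<le> real n * (K * ((h2 - h1) / real n)\<^sup>2)"
        by (intro mult_left_mono) auto
      also have "\<dots> = K * (h2 - h1)\<^sup>2 / real n"
        using elim by (simp add: power2_eq_square)
      finally show ?case by (simp add: abs_mult)
    qed
  qed
  from tendsto_add[OF tendsto_mult_left[OF this, of "1 / 2"]
      tendsto_mult_left[OF survival_deficit_tendsto[OF h], of "1 / 2"]]
  show ?thesis by (simp add: algebra_simps diff_divide_distrib)
qed

text \<open>
  For \<open>u \<le> h\<close> the event has probability one, since the support under \<open>h\<close> starts above the boundary of \<open>u\<close>.
\<close>
lemma prob_all_above_tendsto:
  "(\<lambda>n. measure (local_law Yset p f g \<theta>0 \<gamma> h n) (all_above u n)) \<longlonglongrightarrow> exp (- rate * max (u - h) 0)"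
proof (cases "h < u")
  case True
  have "(\<lambda>n. survival (\<theta>0 + h / real n) (\<theta>0 + u / real n) ^ n) \<longlonglongrightarrow> exp (- (rate * (u - h)))"
    by (intro power_tendsto_exp survival_deficit_tendsto True)
  moreover have "\<forall>\<^sub>F n in sequentially. survival (\<theta>0 + h / real n) (\<theta>0 + u / real n) ^ n
      = measure (local_law Yset p f g \<theta>0 \<gamma> h n) (all_above u n)"
    using eventually_near[of h] by eventually_elim (simp add: measure_all_above survival_def)
  ultimately show ?thesis using True by (simp add: tendsto_cong)
next
  case False
  have "\<forall>\<^sub>F n in sequentially. measure (local_law Yset p f g \<theta>0 \<gamma> h n) (all_above u n) = 1"
    using eventually_near[of h] eventually_near[of u]
  proof eventually_elim
    case (elim n)
    let ?t = "\<theta>0 + h / real n" and ?u = "\<theta>0 + u / real n"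
    have "dens ?t z * indicator (tail ?u) z = dens ?t z" if "z \<in> space base" for z
    proof (cases "g (snd z) ?t \<le> fst z")
      case True
      then have "z \<in> tail ?u"
        using that g_mono[of "snd z" ?u ?t] elim False
        by (auto simp: tail_def space_base divide_right_mono intro: order_trans)
      then show ?thesis by simp
    qed (auto simp: dens_def cond_density_def case_prod_unfold)
    then have "(\<integral> z. dens ?t z * indicator (tail ?u) z \<partial>base) = (\<integral> z. dens ?t z \<partial>base)"
      by (intro Bochner_Integration.integral_cong) auto
    then show ?case using elim by (simp add: measure_all_above dens_integral)
  qed
  then show ?thesis using False by (simp add: tendsto_cong tendsto_eventually)
qed

text \<open>
  The choice \<open>\<kappa>\<^sup>2 = exp (rate * (h2 - h1))\<close> is the limit of the likelihood ratio on the common support; it makes the error term of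
  \<open>product_density_comparison\<close> tend to \<open>1 + 1 - 2 = 0\<close>.
\<close>
lemma shift_comparison:
  assumes h: "h1 < h2" and \<psi>: "test_sequence (sample_space p) \<psi>" and \<eta>: "0 < \<eta>"
  shows "\<forall>\<^sub>F n in sequentially. (\<integral>\<omega>. \<psi> n \<omega> \<partial>local_law Yset p f g \<theta>0 \<gamma> h2 n)
    \<le> (1 + \<eta>) * exp (rate * (h2 - h1)) * (\<integral>\<omega>. \<psi> n \<omega> \<partial>local_law Yset p f g \<theta>0 \<gamma> h1 n) + \<eta>"
proof -
  define \<kappa> where "\<kappa> = exp (rate * (h2 - h1) / 2)"
  have \<kappa>2: "\<kappa>\<^sup>2 = exp (rate * (h2 - h1))"
    by (simp add: \<kappa>_def power2_eq_square flip: exp_add)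
  let ?s = "\<lambda>n. survival (\<theta>0 + h1 / real n) (\<theta>0 + h2 / real n)"
  let ?a = "\<lambda>n. affinity (\<theta>0 + h1 / real n) (\<theta>0 + h2 / real n)"
  have "(\<lambda>n. (1 + 1 / \<eta>) * (1 + \<kappa>\<^sup>2 * ?s n ^ n - 2 * \<kappa> * ?a n ^ n))
    \<longlonglongrightarrow> (1 + 1 / \<eta>) * (1 + \<kappa>\<^sup>2 * exp (- (rate * (h2 - h1))) - 2 * \<kappa> * exp (- (rate * (h2 - h1) / 2)))"
    by (intro tendsto_mult tendsto_add tendsto_diff tendsto_const power_tendsto_exp
        survival_deficit_tendsto affinity_deficit_tendsto h)
  also have "(1 + 1 / \<eta>) * (1 + \<kappa>\<^sup>2 * exp (- (rate * (h2 - h1))) - 2 * \<kappa> * exp (- (rate * (h2 - h1) / 2))) = 0"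
    unfolding \<kappa>2 by (simp add: \<kappa>_def exp_minus)
  finally have "\<forall>\<^sub>F n in sequentially. (1 + 1 / \<eta>) * (1 + \<kappa>\<^sup>2 * ?s n ^ n - 2 * \<kappa> * ?a n ^ n) < \<eta>"
    using \<eta> by (rule order_tendstoD)
  then show ?thesis
    using eventually_near[of h1] eventually_near[of h2]
  proof eventually_elim
    case (elim n)
    let ?t = "\<theta>0 + h1 / real n" and ?u = "\<theta>0 + h2 / real n"
    have "sets (\<Pi>\<^sub>M i\<in>{..<n}. base) = sets (sample_space p n)"
      unfolding sample_space_def base_def by (intro sets_PiM_cong sets_pair_measure_cong) auto
    then have "\<psi> n \<in> borel_measurable (\<Pi>\<^sub>M i\<in>{..<n}. base)"
      and "\<And>\<omega>. \<omega> \<in> space (\<Pi>\<^sub>M i\<in>{..<n}. base) \<Longrightarrow> 0 \<le> \<psi> n \<omega> \<and> \<psi> n \<omega> \<le> 1"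
      using \<psi> sets_eq_imp_space_eq[of "\<Pi>\<^sub>M i\<in>{..<n}. base" "sample_space p n"]
      by (auto simp: test_sequence_def cong: measurable_cong_sets)
    note bound = product_density_comparison[OF sigma_finite_base
        dens_measurable[OF elim(3)] dens_nonneg[OF elim(3)] dens_mass[OF elim(3)]
        dens_measurable[OF elim(2)] dens_nonneg[OF elim(2)] dens_mass[OF elim(2)]
        _ _ _ this \<eta>, of "\<lambda>z. dens ?t z * indicator (tail ?u) z" \<kappa>]
    have "(\<integral>\<omega>. \<psi> n \<omega> \<partial>local_law Yset p f g \<theta>0 \<gamma> h2 n)
      \<le> (1 + \<eta>) * \<kappa>\<^sup>2 * (\<integral>\<omega>. \<psi> n \<omega> \<partial>local_law Yset p f g \<theta>0 \<gamma> h1 n)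
        + (1 + 1 / \<eta>) * (1 + \<kappa>\<^sup>2 * ?s n ^ n - 2 * \<kappa> * ?a n ^ n)"
      unfolding local_law_def sample_law_def obs_law_eq[OF elim(2)] obs_law_eq[OF elim(3)]
        survival_def affinity_def
      by (rule bound)
        (use dens_measurable[OF elim(2)] dens_nonneg[OF elim(2)] tail_sets in
          \<open>auto split: split_indicator\<close>)
    then show ?case using elim(1) by (simp add: \<kappa>2)
  qed
qed

text \<open>
  As the boundary increases, an estimated cutoff strictly between \<open>b - e\<close> and \<open>b + e\<close> puts the estimated boundary strictly
  between the boundaries of these two values; this also settles the difference between \<open>>\<close> and \<open>\<ge>\<close> in the rejection rule.
\<close>
lemma boundary_test_sandwich:
  assumes test: "boundary_test \<Theta> p g \<theta>0 hhat \<phi>"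
    and \<Theta>: "\<And>t. \<bar>t - \<theta>0\<bar> < \<delta> \<Longrightarrow> t \<in> \<Theta>"
    and e: "0 < e" "e < b"
  shows "\<forall>\<^sub>F n in sequentially. \<forall>\<omega>\<in>space (sample_space p n). \<bar>hhat n \<omega> - b\<bar> < e \<longrightarrow>
      indicator (all_above (b + e) n) \<omega> + 1 - indicator (all_above 0 n) \<omega> \<le> \<phi> n \<omega> \<and>
      \<phi> n \<omega> \<le> indicator (all_above (b - e) n) \<omega> + 1 - indicator (all_above 0 n) \<omega>"
  using eventually_near[of "b + e"] eventually_near[of "b - e"] eventually_gt_at_top[of 0]
proof eventually_elim
  case (elim n)
  show ?case
  proof (intro ballI impI)
    fix \<omega> assume \<omega>: "\<omega> \<in> space (sample_space p n)" and close: "\<bar>hhat n \<omega> - b\<bar> < e"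
    define s where "s = \<theta>0 + hhat n \<omega> / real n"
    have s: "\<theta>0 + (b - e) / real n < s" "s < \<theta>0 + (b + e) / real n"
      using close elim by (auto simp: s_def intro!: divide_strict_right_mono)
    then have near: "\<bar>s - \<theta>0\<bar> < \<delta>" using elim by linarith
    have X: "snd (\<omega> i) \<in> set_pmf p" if "i < n" for i
      using \<omega> that by (auto simp: sample_space_def space_PiM space_pair_measure PiE_def Pi_def mem_Times_iff)
    have lo: "g (snd (\<omega> i)) (\<theta>0 + (b - e) / real n) < g (snd (\<omega> i)) s" if "i < n" for i
      by (rule g_strict_mono[OF X[OF that] _ near s(1)]) (use elim in simp)
    have hi: "g (snd (\<omega> i)) s < g (snd (\<omega> i)) (\<theta>0 + (b + e) / real n)" if "i < n" for i
      by (rule g_strict_mono[OF X[OF that] near _ s(2)]) (use elim in simp)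
    have rule: "(\<forall>i<n. g (snd (\<omega> i)) s < fst (\<omega> i)) \<or> (\<exists>i<n. fst (\<omega> i) < g (snd (\<omega> i)) \<theta>0) \<Longrightarrow> \<phi> n \<omega> = 1"
      "(\<exists>i<n. fst (\<omega> i) \<le> g (snd (\<omega> i)) s) \<and> (\<forall>i<n. g (snd (\<omega> i)) \<theta>0 \<le> fst (\<omega> i)) \<Longrightarrow> \<phi> n \<omega> = 0"
      using test \<omega> \<Theta>[OF near] unfolding boundary_test_def Let_def s_def by auto
    have \<phi>01: "0 \<le> \<phi> n \<omega>" "\<phi> n \<omega> \<le> 1"
      using test \<omega> by (auto simp: boundary_test_def test_sequence_def)
    have A: "\<omega> \<in> all_above u n \<longleftrightarrow> (\<forall>i<n. g (snd (\<omega> i)) (\<theta>0 + u / real n) \<le> fst (\<omega> i))" for u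
      using \<omega> by (simp add: all_above_def)
    have 1: "\<phi> n \<omega> = 1" if "\<omega> \<in> all_above (b + e) n \<or> \<omega> \<notin> all_above 0 n"
      using that hi by (intro rule(1)) (force simp: A not_le)
    have 2: "\<phi> n \<omega> = 0" if "\<omega> \<notin> all_above (b - e) n" "\<omega> \<in> all_above 0 n"
      using that lo by (intro rule(2)) (force simp: A not_le)
    have 3: "\<omega> \<in> all_above 0 n" if above: "\<omega> \<in> all_above (b + e) n"
      unfolding A
    proof (intro allI impI)
      fix i assume i: "i < n"
      have "g (snd (\<omega> i)) (\<theta>0 + 0 / real n) \<le> g (snd (\<omega> i)) (\<theta>0 + (b + e) / real n)"
        using e elim radius by (intro g_mono X i) auto
      also have "\<dots> \<le> fst (\<omega> i)" using above i by (simp add: A)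
      finally show "g (snd (\<omega> i)) (\<theta>0 + 0 / real n) \<le> fst (\<omega> i)" .
    qed
    show "indicator (all_above (b + e) n) \<omega> + 1 - indicator (all_above 0 n) \<omega> \<le> \<phi> n \<omega> \<and>
      \<phi> n \<omega> \<le> indicator (all_above (b - e) n) \<omega> + 1 - indicator (all_above 0 n) \<omega>"
      using 1 2 3 \<phi>01 by (auto split: split_indicator)
  qed
qed

end

section \<open>Smoothness and boundedness in probability\<close>

text \<open>
  Continuity of \<open>Dg\<close> makes the boundary increasing near \<open>\<theta>\<^sub>0\<close>. For the bound on \<open>sqrt f\<close>, the mean value theorem gives the
  difference quotient as \<open>D / (2 sqrt f)\<close> at an intermediate \<open>s\<close>, with \<open>D\<close> the derivative of \<open>f\<close> in \<open>\<theta>\<close>; its square is at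
  most the squared score times \<open>f\<close>, both at \<open>(s, \<gamma>)\<close>. This is one of the quantities in the double supremum of the second moment condition, with both
  parameters equal to \<open>(s, \<gamma>)\<close>: the indicator there is \<open>1\<close> because \<open>y\<close> is above the boundary at \<open>u > s\<close>.
\<close>
lemma regular_boundary_model_of_assumption_B:
  fixes p :: "(real ^ 'k::finite) pmf"
    and f :: "real \<Rightarrow> real ^ 'k \<Rightarrow> real \<times> (real ^ 'd::finite) \<Rightarrow> real"
  assumes B_i: "assumption_B_i \<Theta> \<Gamma> H Yset p f g \<theta>0 \<gamma>"
    and B_iii: "assumption_B_iii \<Theta> \<Gamma> Yset p f g Df DDf Dg \<theta>0 \<gamma>"
  obtains \<delta> C S where "regular_boundary_model Yset p f g \<theta>0 \<gamma> \<delta> C (\<lambda>x. Dg x \<theta>0) S"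
    and "\<And>t. \<bar>t - \<theta>0\<bar> < \<delta> \<Longrightarrow> t \<in> \<Theta>"
proof -
  have i: "Yset \<in> sets borel" "finite (set_pmf p)" "\<theta>0 \<in> interior \<Theta>"
    "\<And>\<beta> x. \<beta> \<in> \<Theta> \<times> \<Gamma> \<Longrightarrow> x \<in> set_pmf p \<Longrightarrow> cond_density Yset f g x \<beta> \<in> borel_measurable borel"
    "\<And>\<beta> x. \<beta> \<in> \<Theta> \<times> \<Gamma> \<Longrightarrow> x \<in> set_pmf p \<Longrightarrow> (\<integral>\<^sup>+ y. ennreal (cond_density Yset f g x \<beta> y) \<partial>lborel) = 1"
    using B_i by (auto simp: assumption_B_i_def)
  have f_diff: "\<And>x y \<beta>. x \<in> set_pmf p \<Longrightarrow> y \<in> Yset \<Longrightarrow> \<beta> \<in> \<Theta> \<times> \<Gamma> \<Longrightarrow>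
      (f y x has_derivative (\<lambda>v. Df y x \<beta> \<bullet> v)) (at \<beta> within \<Theta> \<times> \<Gamma>)"
    using B_iii unfolding assumption_B_iii_def twice_cont_differentiable_def by blast
  have g_diff: "\<And>x t. x \<in> set_pmf p \<Longrightarrow> t \<in> \<Theta> \<Longrightarrow> (g x has_real_derivative Dg x t) (at t within \<Theta>)"
    and Dg_cont: "\<And>x. x \<in> set_pmf p \<Longrightarrow> continuous_on \<Theta> (Dg x)"
    using B_iii unfolding assumption_B_iii_def by blast+
  have "\<exists>N. open N \<and> (\<theta>0, \<gamma>) \<in> N \<and> N \<subseteq> \<Theta> \<times> \<Gamma> \<and>
      (\<forall>x\<in>set_pmf p. \<forall>\<beta>\<in>N. g x (fst \<beta>) \<in> Yset \<and> continuous_on Yset (\<lambda>y. f y x \<beta>)) \<and>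
      (\<exists>C. \<forall>x\<in>set_pmf p. \<forall>\<beta>\<in>N. \<forall>y\<in>Yset. 0 < f y x \<beta> \<and> f y x \<beta> < C \<and> norm (Df y x \<beta>) < C) \<and>
      (\<forall>x\<in>set_pmf p. (\<integral>\<^sup>+ y\<in>Yset. (SUP b\<in>N. SUP \<beta>\<in>N.
            ennreal ((norm (Df y x b))\<^sup>2 / (f y x b)\<^sup>2 * f y x \<beta>) * indicator {g x (fst \<beta>)..} y) \<partial>lborel) < \<infinity>) \<and>
      (\<forall>x\<in>set_pmf p. 0 < Dg x \<theta>0)"
    using B_iii unfolding assumption_B_iii_def by (elim conjE exE) (intro exI conjI; blast)
  then obtain N C where N: "open N" "(\<theta>0, \<gamma>) \<in> N" "N \<subseteq> \<Theta> \<times> \<Gamma>"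
    and g_f: "\<forall>x\<in>set_pmf p. \<forall>\<beta>\<in>N. g x (fst \<beta>) \<in> Yset \<and> continuous_on Yset (\<lambda>y. f y x \<beta>)"
    and ex_C: "\<forall>x\<in>set_pmf p. \<forall>\<beta>\<in>N. \<forall>y\<in>Yset. 0 < f y x \<beta> \<and> f y x \<beta> < C \<and> norm (Df y x \<beta>) < C"
    and S_fin: "\<forall>x\<in>set_pmf p. (\<integral>\<^sup>+ y\<in>Yset. (SUP b\<in>N. SUP \<beta>\<in>N.
            ennreal ((norm (Df y x b))\<^sup>2 / (f y x b)\<^sup>2 * f y x \<beta>) * indicator {g x (fst \<beta>)..} y) \<partial>lborel) < \<infinity>"
    and Dg_pos: "\<forall>x\<in>set_pmf p. 0 < Dg x \<theta>0"
    by (elim exE conjE) (rule that)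
  have C: "0 < f y x \<beta> \<and> norm (Df y x \<beta>) < C" if "x \<in> set_pmf p" "\<beta> \<in> N" "y \<in> Yset" for x \<beta> y
    using ex_C that by blast
  have Dg_isCont: "isCont (Dg x) \<theta>0" if "x \<in> set_pmf p" for x
    using Dg_cont[OF that] i(3) by (rule continuous_on_interior)
  have "((\<lambda>t. (t, \<gamma>)) \<longlongrightarrow> (\<theta>0, \<gamma>)) (nhds \<theta>0)"
    by (intro tendsto_Pair tendsto_const filterlim_ident)
  then have "\<forall>\<^sub>F t in nhds \<theta>0. (t, \<gamma>) \<in> N"
    using N(1,2) by (rule topological_tendstoD)
  moreover have "\<forall>\<^sub>F t in nhds \<theta>0. \<forall>x\<in>set_pmf p. 0 < Dg x t"
  proof (subst eventually_ball_finite_distrib[OF i(2)], rule ballI)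
    fix x assume x: "x \<in> set_pmf p"
    have "(Dg x \<longlongrightarrow> Dg x \<theta>0) (nhds \<theta>0)"
      using Dg_isCont[OF x] by (simp add: tendsto_at_iff_tendsto_nhds isCont_def)
    then show "\<forall>\<^sub>F t in nhds \<theta>0. 0 < Dg x t"
      using Dg_pos x by (auto intro: order_tendstoD)
  qed
  ultimately have "\<forall>\<^sub>F t in nhds \<theta>0. (t, \<gamma>) \<in> N \<and> (\<forall>x\<in>set_pmf p. 0 < Dg x t)"
    by eventually_elim simp
  then obtain \<delta> where \<delta>: "0 < \<delta>" "\<And>t. \<bar>t - \<theta>0\<bar> < \<delta> \<Longrightarrow> (t, \<gamma>) \<in> N"
    "\<And>t x. \<bar>t - \<theta>0\<bar> < \<delta> \<Longrightarrow> x \<in> set_pmf p \<Longrightarrow> 0 < Dg x t"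
    unfolding eventually_nhds_metric dist_real_def by blast
  have \<Theta>: "t \<in> \<Theta>" and TG: "(t, \<gamma>) \<in> \<Theta> \<times> \<Gamma>" if "\<bar>t - \<theta>0\<bar> < \<delta>" for t
    using \<delta>(2)[OF that] N(3) by auto
  have "{\<theta>0 - \<delta> <..< \<theta>0 + \<delta>} \<subseteq> interior \<Theta>"
    using \<Theta> by (intro interior_maximal) (auto simp: abs_less_iff)
  then have int: "t \<in> interior \<Theta>" if "\<bar>t - \<theta>0\<bar> < \<delta>" for t
    using that by (auto simp: abs_less_iff)
  have f_DERIV: "((\<lambda>t. f y x (t, \<gamma>)) has_real_derivative Df y x (t, \<gamma>) \<bullet> (1, 0)) (at t)"
    if x: "x \<in> set_pmf p" and y: "y \<in> Yset" and t: "\<bar>t - \<theta>0\<bar> < \<delta>" for x y t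
  proof -
    have "at (t, \<gamma>) within \<Theta> \<times> \<Gamma> = at (t, \<gamma>)"
      using N \<delta>(2)[OF t] by (intro at_within_interior) (auto intro: interiorI)
    then have "(f y x has_derivative (\<lambda>v. Df y x (t, \<gamma>) \<bullet> v)) (at (t, \<gamma>))"
      using f_diff[OF x y TG[OF t]] by simp
    moreover have "((\<lambda>t. (t, \<gamma>)) has_derivative (\<lambda>v. (v, 0))) (at t)"
      by (auto intro!: derivative_eq_intros)
    ultimately have "((\<lambda>t. f y x (t, \<gamma>)) has_derivative (\<lambda>v. Df y x (t, \<gamma>) \<bullet> (v, 0))) (at t)"
      by (rule has_derivative_compose[rotated])
    then show ?thesis
      by (rule has_derivative_imp_has_field_derivative) (simp add: inner_prod_def)
  qed
  have dir: "\<bar>Df y x \<beta> \<bullet> (1, 0)\<bar> \<le> norm (Df y x \<beta>)" for y x \<beta>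
    using Cauchy_Schwarz_ineq2[of "Df y x \<beta>" "(1, 0)"] by (simp add: norm_Pair)
  have g_DERIV: "(g x has_real_derivative Dg x t) (at t)"
    if "x \<in> set_pmf p" "\<bar>t - \<theta>0\<bar> < \<delta>" for x t
    using g_diff[OF that(1) \<Theta>[OF that(2)]] at_within_interior[OF int[OF that(2)]] by simp
  have g_strict: "g x t < g x u"
    if x: "x \<in> set_pmf p" and "\<bar>t - \<theta>0\<bar> < \<delta>" "\<bar>u - \<theta>0\<bar> < \<delta>" "t < u" for x t u
  proof (rule DERIV_pos_imp_increasing[OF \<open>t < u\<close>])
    fix s assume "t \<le> s" "s \<le> u"
    then have "\<bar>s - \<theta>0\<bar> < \<delta>" using that by linarith
    then show "\<exists>y. (g x has_real_derivative y) (at s) \<and> 0 < y"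
      using g_DERIV[OF x] \<delta>(3)[OF _ x] by blast
  qed
  define S where "S x y = (SUP b\<in>N. SUP \<beta>\<in>N.
    ennreal ((norm (Df y x b))\<^sup>2 / (f y x b)\<^sup>2 * f y x \<beta>) * indicator {g x (fst \<beta>)..} y)" for x y
  have "regular_boundary_model Yset p f g \<theta>0 \<gamma> \<delta> C (\<lambda>x. Dg x \<theta>0) S"
  proof
    fix x t and y assume x: "x \<in> set_pmf p" and t: "\<bar>t - \<theta>0\<bar> < \<delta>" and y: "y \<in> Yset"
    have "norm (f y x (t, \<gamma>) - f y x (\<theta>0, \<gamma>)) \<le> C * norm (t - \<theta>0)"
    proof (rule field_differentiable_bound[where S="{\<theta>0 - \<delta> <..< \<theta>0 + \<delta>}"])
      fix s assume "s \<in> {\<theta>0 - \<delta> <..< \<theta>0 + \<delta>}"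
      then have s: "\<bar>s - \<theta>0\<bar> < \<delta>" by auto
      show "((\<lambda>t. f y x (t, \<gamma>)) has_real_derivative Df y x (s, \<gamma>) \<bullet> (1, 0)) (at s within {\<theta>0 - \<delta><..<\<theta>0 + \<delta>})"
        using f_DERIV[OF x y s] by (rule has_field_derivative_at_within)
      show "norm (Df y x (s, \<gamma>) \<bullet> (1, 0)) \<le> C"
        using dir[of y x "(s, \<gamma>)"] C[OF x \<delta>(2)[OF s] y] by simp
    qed (use t \<delta>(1) in auto)
    then show "\<bar>f y x (t, \<gamma>) - f y x (\<theta>0, \<gamma>)\<bar> \<le> C * \<bar>t - \<theta>0\<bar>" by simp
  next
    fix x t u y
    assume x: "x \<in> set_pmf p" and t: "\<bar>t - \<theta>0\<bar> < \<delta>" and u: "\<bar>u - \<theta>0\<bar> < \<delta>" and tu: "t < u"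
      and y: "y \<in> Yset" and gy: "g x u \<le> y"
    let ?F = "\<lambda>s. f y x (s, \<gamma>)" and ?D = "\<lambda>s. Df y x (s, \<gamma>)"
    have near: "\<bar>s - \<theta>0\<bar> < \<delta>" if "t \<le> s" "s \<le> u" for s using that t u by linarith
    have pos: "0 < ?F s" if "t \<le> s" "s \<le> u" for s
      using C[OF x \<delta>(2)[OF near[OF that]] y] by simp
    have "\<exists>s. t < s \<and> s < u \<and> sqrt (?F u) - sqrt (?F t) = (u - t) * (inverse (sqrt (?F s)) / 2 * (?D s \<bullet> (1, 0)))"
    proof (rule MVT2[OF tu])
      fix s assume s: "t \<le> s" "s \<le> u"
      show "((\<lambda>s. sqrt (?F s)) has_real_derivative inverse (sqrt (?F s)) / 2 * (?D s \<bullet> (1, 0))) (at s)"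
        using DERIV_real_sqrt[OF pos[OF s]] f_DERIV[OF x y near[OF s]] by (rule DERIV_chain2)
    qed
    then obtain s where s: "t < s" "s < u"
      and mvt: "sqrt (?F u) - sqrt (?F t) = (u - t) * (inverse (sqrt (?F s)) / 2 * (?D s \<bullet> (1, 0)))"
      by blast
    have sN: "(s, \<gamma>) \<in> N" and Fs: "0 < ?F s" using s \<delta>(2)[OF near] pos by auto
    have "(sqrt (?F u) - sqrt (?F t))\<^sup>2 / (u - t)\<^sup>2 = (inverse (sqrt (?F s)) / 2 * (?D s \<bullet> (1, 0)))\<^sup>2"
      unfolding mvt power_mult_distrib[of "u - t"] using tu by simp
    also have "\<dots> = (?D s \<bullet> (1, 0))\<^sup>2 / ?F s / 4"
      using Fs by (simp add: power_mult_distrib power_divide power_inverse field_simps)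
    also have "\<dots> \<le> (norm (?D s))\<^sup>2 / ?F s"
    proof -
      have "(?D s \<bullet> (1, 0))\<^sup>2 \<le> (norm (?D s))\<^sup>2"
        using power_mono[OF dir[of y x "(s, \<gamma>)"], of 2] by simp
      then have "(?D s \<bullet> (1, 0))\<^sup>2 / ?F s \<le> (norm (?D s))\<^sup>2 / ?F s"
        using Fs by (intro divide_right_mono) auto
      moreover have "0 \<le> (?D s \<bullet> (1, 0))\<^sup>2 / ?F s" using Fs by simp
      moreover have "a / 4 \<le> b" if "a \<le> b" "0 \<le> a" for a b :: real
        using that by linarith
      ultimately show ?thesis by blast
    qed
    also have "\<dots> = (norm (?D s))\<^sup>2 / (?F s)\<^sup>2 * ?F s"
      using Fs by (simp add: power2_eq_square)
    finally have "ennreal ((sqrt (?F u) - sqrt (?F t))\<^sup>2 / (u - t)\<^sup>2)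
      \<le> ennreal ((norm (?D s))\<^sup>2 / (?F s)\<^sup>2 * ?F s)"
      by (rule ennreal_leI)
    also have "\<dots> = ennreal ((norm (?D s))\<^sup>2 / (?F s)\<^sup>2 * ?F s) * indicator {g x (fst (s, \<gamma>))..} y"
      using g_strict[OF x near u, of s] s gy by simp
    also have "\<dots> \<le> S x y"
      unfolding S_def by (rule SUP_upper2[OF sN], rule SUP_upper2[OF sN]) simp
    finally show "ennreal ((sqrt (?F u) - sqrt (?F t))\<^sup>2 / (u - t)\<^sup>2) \<le> S x y" .
  next
    fix x assume x: "x \<in> set_pmf p"
    show "continuous_on {\<theta>0 - \<delta><..<\<theta>0 + \<delta>} (g x)"
      by (rule DERIV_continuous_on[where D="Dg x"], rule has_field_derivative_at_within, rule g_DERIV[OF x])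
        (auto simp: abs_less_iff)
  next
    fix x assume x: "x \<in> set_pmf p"
    show "(\<integral>\<^sup>+ y\<in>Yset. S x y \<partial>lborel) < \<infinity>" unfolding S_def by (rule S_fin[rule_format, OF x])
  next
    fix x t assume x: "x \<in> set_pmf p" and t: "\<bar>t - \<theta>0\<bar> < \<delta>"
    show "g x t \<in> Yset" using bspec[OF bspec[OF g_f x] \<delta>(2)[OF t]] by simp
    show "cond_density Yset f g x (t, \<gamma>) \<in> borel_measurable borel"
      "(\<integral>\<^sup>+ y. ennreal (cond_density Yset f g x (t, \<gamma>) y) \<partial>lborel) = 1"
      using i(4,5)[OF TG[OF t] x] by auto
    show "0 < f y x (t, \<gamma>)" if "y \<in> Yset" for y using C[OF x \<delta>(2)[OF t] that] by simp
  qed (use i \<delta>(1) N(2) g_f g_strict g_DERIV Dg_pos in auto)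
  then show ?thesis using that \<Theta> by blast
qed

lemma bounded_in_prob_imp_tendsto_zero:
  fixes T :: "nat \<Rightarrow> 'w \<Rightarrow> real"
  assumes prob: "\<forall>\<^sub>F n in sequentially. prob_space (P n) \<and> T n \<in> borel_measurable (P n)"
    and bdd: "bounded_in_prob P (\<lambda>n \<omega>. sqrt (real n) * (T n \<omega> - b))"
    and e: "0 < e"
  shows "(\<lambda>n. measure (P n) {\<omega> \<in> space (P n). e \<le> \<bar>T n \<omega> - b\<bar>}) \<longlonglongrightarrow> 0"
proof (rule LIMSEQ_I)
  fix r :: real assume r: "0 < r"
  then obtain B where B: "\<forall>\<^sub>F n in sequentially.
      measure (P n) {\<omega> \<in> space (P n). norm (sqrt (real n) * (T n \<omega> - b)) > B} \<le> r / 2"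
    using bdd unfolding bounded_in_prob_def by (meson half_gt_zero)
  have "filterlim (\<lambda>n. sqrt (real n)) at_top sequentially"
    by (rule filterlim_compose[OF sqrt_at_top filterlim_real_sequentially])
  then have "\<forall>\<^sub>F n in sequentially. B / e < sqrt (real n)"
    by (simp add: filterlim_at_top_dense)
  with B prob have "\<forall>\<^sub>F n in sequentially. norm (measure (P n) {\<omega> \<in> space (P n). e \<le> \<bar>T n \<omega> - b\<bar>} - 0) < r"
  proof eventually_elim
    case (elim n)
    interpret prob_space "P n" using elim by simp
    have [measurable]: "T n \<in> borel_measurable (P n)" using elim by simp
    have "measure (P n) {\<omega> \<in> space (P n). e \<le> \<bar>T n \<omega> - b\<bar>}
      \<le> measure (P n) {\<omega> \<in> space (P n). norm (sqrt (real n) * (T n \<omega> - b)) > B}"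
    proof (rule finite_measure_mono)
      have "B < sqrt (real n) * \<bar>T n \<omega> - b\<bar>" if "e \<le> \<bar>T n \<omega> - b\<bar>" for \<omega>
      proof -
        have "B < sqrt (real n) * e" using elim e by (simp add: field_simps)
        also have "\<dots> \<le> sqrt (real n) * \<bar>T n \<omega> - b\<bar>" using that by (intro mult_left_mono) auto
        finally show ?thesis .
      qed
      then show "{\<omega> \<in> space (P n). e \<le> \<bar>T n \<omega> - b\<bar>}
        \<subseteq> {\<omega> \<in> space (P n). norm (sqrt (real n) * (T n \<omega> - b)) > B}"
        by (auto simp: abs_mult)
      show "{\<omega> \<in> space (P n). norm (sqrt (real n) * (T n \<omega> - b)) > B} \<in> sets (P n)" by measurable
    qed
    then show ?case using elim r by simp
  qed
  then show "\<exists>no. \<forall>n\<ge>no. norm (measure (P n) {\<omega> \<in> space (P n). e \<le> \<bar>T n \<omega> - b\<bar>} - 0) < r"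
    by (simp add: eventually_sequentially)
qed

section \<open>Optimality of the boundary test\<close>

theorem theorem6:
  fixes \<Theta> :: "real set" and \<Gamma> :: "(real ^ 'd::finite) set" and H Yset :: "real set"
    and p :: "(real ^ 'k::finite) pmf"
    and f :: "real \<Rightarrow> real ^ 'k \<Rightarrow> real \<times> (real ^ 'd) \<Rightarrow> real"
    and g :: "real ^ 'k \<Rightarrow> real \<Rightarrow> real"
    and Df :: "real \<Rightarrow> real ^ 'k \<Rightarrow> real \<times> (real ^ 'd) \<Rightarrow> real \<times> (real ^ 'd)"
    and DDf :: "real \<Rightarrow> real ^ 'k \<Rightarrow> real \<times> (real ^ 'd)
                  \<Rightarrow> (real \<times> (real ^ 'd)) \<Rightarrow>\<^sub>L (real \<times> (real ^ 'd))"
    and Dg :: "real ^ 'k \<Rightarrow> real \<Rightarrow> real"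
    and \<alpha> \<theta>0 hbar :: real and \<gamma> :: "real ^ 'd"
    and hhat :: "nat \<Rightarrow> (nat \<Rightarrow> real \<times> (real ^ 'k)) \<Rightarrow> real"
    and \<gamma>hat :: "nat \<Rightarrow> (nat \<Rightarrow> real \<times> (real ^ 'k)) \<Rightarrow> real ^ 'd"
    and \<phi> :: "nat \<Rightarrow> (nat \<Rightarrow> real \<times> (real ^ 'k)) \<Rightarrow> real"
  assumes alpha: "0 < \<alpha>" "\<alpha> < 1"
    and B_i: "assumption_B_i \<Theta> \<Gamma> H Yset p f g \<theta>0 \<gamma>"
    and B_ii: "\<And>h. h \<in> H \<Longrightarrow> assumption_B_ii Yset p f g \<theta>0 \<gamma> hbar hhat \<gamma>hat h"
    and B_iii: "assumption_B_iii \<Theta> \<Gamma> Yset p f g Df DDf Dg \<theta>0 \<gamma>"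
    and hbar_eq: "hbar = boundary_rate p f g Dg \<theta>0 \<gamma> * ln (1 / \<alpha>)"
    and hbar_mem: "hbar \<in> H"
    and test: "boundary_test \<Theta> p g \<theta>0 hhat \<phi>"
  shows "AUMP (sample_space p) (local_law Yset p f g \<theta>0 \<gamma>) H \<alpha> \<phi>"
proof -
  obtain \<delta> C S where "regular_boundary_model Yset p f g \<theta>0 \<gamma> \<delta> C (\<lambda>x. Dg x \<theta>0) S"
    and \<Theta>: "\<And>t. \<bar>t - \<theta>0\<bar> < \<delta> \<Longrightarrow> t \<in> \<Theta>"
    by (rule regular_boundary_model_of_assumption_B[OF B_i B_iii]) (rule that)
  then interpret regular_boundary_model Yset p f g \<theta>0 \<gamma> \<delta> C "\<lambda>x. Dg x \<theta>0" S by simp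
  let ?P = "local_law Yset p f g \<theta>0 \<gamma>"
  have hbar: "hbar = ln (1 / \<alpha>) / rate"
    by (simp add: hbar_eq boundary_rate_def rate_def field_simps)
  have hbar_pos: "0 < hbar" using alpha rate_pos by (simp add: hbar)
  \<comment> \<open>The cutoff is the \<open>1 - \<alpha>\<close> quantile of the exponential limit, so the envelope at \<open>h = 0\<close> is \<open>\<alpha>\<close>.\<close>
  have \<alpha>: "exp (- (rate * hbar)) = \<alpha>"
    using alpha rate_pos by (simp add: hbar ln_div)
  have H0: "0 \<in> H" using B_i by (simp add: assumption_B_i_def)
  have \<phi>: "test_sequence (sample_space p) \<phi>" using test by (simp add: boundary_test_def)
  have attained: "(\<lambda>n. \<integral>\<omega>. \<phi> n \<omega> \<partial>?P h n) \<longlonglongrightarrow> power_envelope rate hbar h" if h: "h \<in> H" for h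
  proof (rule envelope_attained[OF hbar_pos eventually_prob_space \<phi> all_above_sets prob_all_above_tendsto])
    show T: "hhat n \<in> borel_measurable (sample_space p n)" for n
      using B_ii[OF h] by (simp add: assumption_B_ii_def)
    show "(\<lambda>n. measure (?P h n) {\<omega> \<in> space (?P h n). e \<le> \<bar>hhat n \<omega> - hbar\<bar>}) \<longlonglongrightarrow> 0"
      if "0 < e" for e
    proof (rule bounded_in_prob_imp_tendsto_zero[OF _ _ that])
      show "\<forall>\<^sub>F n in sequentially. prob_space (?P h n) \<and> hhat n \<in> borel_measurable (?P h n)"
        using eventually_prob_space[of h] T
        by (auto elim!: eventually_mono cong: measurable_cong_sets)
      show "bounded_in_prob (?P h) (\<lambda>n \<omega>. sqrt (real n) * (hhat n \<omega> - hbar))"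
        using B_ii[OF h] by (simp add: assumption_B_ii_def)
    qed
  qed (rule boundary_test_sandwich[OF test \<Theta>])
  show ?thesis
    unfolding AUMP_def
  proof (intro conjI allI impI ballI)
    show "test_sequence (sample_space p) \<phi>" by (rule \<phi>)
    have "power_envelope rate hbar 0 = \<alpha>" using hbar_pos \<alpha> by (simp add: power_envelope_def)
    then have "(\<lambda>n. ereal (\<integral>\<omega>. \<phi> n \<omega> \<partial>?P 0 n)) \<longlonglongrightarrow> ereal \<alpha>"
      using attained[OF H0] by simp
    from lim_imp_Limsup[OF sequentially_bot this] show "asymp_level ?P \<alpha> \<phi>"
      by (simp add: asymp_level_def)
  next
    fix \<psi> h assume \<psi>: "test_sequence (sample_space p) \<psi> \<and> asymp_level ?P \<alpha> \<psi>"
      and h: "h \<in> H" "h \<noteq> 0"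
    have "limsup (\<lambda>n. ereal (\<integral>\<omega>. \<psi> n \<omega> \<partial>?P h n)) \<le> ereal (power_envelope rate hbar h)"
      using \<psi> h by (intro envelope_upper_bound[OF rate_pos hbar_pos eventually_prob_space shift_comparison])
        (auto simp: \<alpha>)
    also have "ereal (power_envelope rate hbar h) = liminf (\<lambda>n. ereal (\<integral>\<omega>. \<phi> n \<omega> \<partial>?P h n))"
      using attained[OF h(1)] by (intro lim_imp_Liminf[symmetric]) auto
    finally show "limsup (\<lambda>n. ereal (\<integral>\<omega>. \<psi> n \<omega> \<partial>?P h n)) \<le> liminf (\<lambda>n. ereal (\<integral>\<omega>. \<phi> n \<omega> \<partial>?P h n))" .
  qed
qed

end
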